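(* Let $k,r\ge 0$ be integers with $k+r\ge 2$ and $d=2k+r\ge 3$, let $G$ be the free product of $k$ copies of $\mathbb{Z}$ and $r$ copies of $\mathbb{Z}_2$, with symmetric generating set $S=\{s_1,\dots,s_d\}$, and let $\mathbb{T}_d$ be the (left) Cayley graph of $G$ with respect to $S$ (the $d$-regular infinite tree), rooted at the identity $e$. Let $P$ be an environment distribution on $(\Omega,\mathcal{F})$ such that: (i) $P$ is a product measure on $(\Omega,\mathcal{F})$, i.e. under $P$ the random probability laws $\{\omega(x,\cdot) : x\in \mathbb{T}_d\}$ are independent, and they are identically distributed in the sense that $P\circ\theta_x^{-1}=P$ for all $x\in G$; (ii) there exists $\epsilon>\frac{1}{2(d-1)}$ such that $P\left(\omega(e,s_i)>\epsilon \text{ for all } 1\le i\le d\right)=1$. Let $(X_n)_{n\ge 0}$ be the random walk in the random environment with law $P$, started at $e$. Then, $\mathbb{P}^e$-almost surely, $$\liminf_{n\to\infty}\frac{|X_n|}{n}>0.$$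
   Context: Group and tree. $G$ is the free product of groups $G_1,\dots,G_k$ and $H_1,\dots,H_r$, where $G_i=\langle a_i\rangle\cong\mathbb{Z}$ and $H_j=\langle b_j\rangle\cong\mathbb{Z}_2$ (so $b_j^2=e$). The generating set is $S=\{a_1,\dots,a_k\}\cup\{a_1^{-1},\dots,a_k^{-1}\}\cup\{b_1,\dots,b_r\}$, which is symmetric and has $d=2k+r$ elements, enumerated as $s_1,\dots,s_d$. The left Cayley graph has vertex set $G$ and edge set $\{\{x,y\} : yx^{-1}\in S\}$; it is a $d$-regular infinite tree, denoted $\mathbb{T}_d$, with root the identity $e$. For $x\in\mathbb{T}_d$, $N(x)=\{y\in G : yx^{-1}\in S\}$ is the set of neighbors of $x$ (so $N(e)=S$), and $|x|$ is the length of the unique path from $e$ to $x$ (with $|e|=0$). For $x\in G$, the translation $\theta_x:G\to G$, $\theta_x(y)=yx$, is an automorphism of $\mathbb{T}_d$. Environment. $\mathcal{S}=\mathcal{S}_e$ is a collection of probability measures on the $d$-element set $N(e)=S$, assumed to be a Polish space, with Borel $\sigma$-algebra for which the evaluation maps $p\mapsto p(s)$, $s\in S$, are measurable. For each $x\in\mathbb{T}_d$, $\mathcal{S}_x=\mathcal{S}\circ\theta_x^{-1}$ is the push-forward of $\mathcal{S}$ under $\theta_x$, so an element $\omega(x,\cdot)\in\mathcal{S}_x$ is a probability measure supported on $N(x)$: $\omega(x,y)\ge 0$ for all $y\in \mathbb{T}_d$ and $\sum_{y\in N(x)}\omega(x,y)=1$. The environment space is $\Omega=\prod_{x\in\mathbb{T}_d}\mathcal{S}_x$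 with the product $\sigma$-algebra $\mathcal{F}=\bigotimes_{x\in\mathbb{T}_d}\mathcal{B}_{\mathcal{S}_x}$, where $\mathcal{B}_{\mathcal{S}_x}$ is the Borel $\sigma$-algebra of $\mathcal{S}_x$. An environment is $\omega=\{\omega(x,\cdot) : x\in\mathbb{T}_d\}\in\Omega$. An environment distribution is a probability measure $P$ on $(\Omega,\mathcal{F})$. In $P\circ\theta_x^{-1}$, $\theta_x$ acts on $\Omega$ by the induced translation of environments, $(\theta_x\omega)(y,z)=\omega(yx^{-1},zx^{-1})$; together with the product property, the invariance says that the random vectors $(\omega(x,sx))_{s\in S}$, $x\in G$, are i.i.d. Random walk. Given $\omega\in\Omega$, $(X_n)_{n\ge0}$ is the time-homogeneous Markov chain on $\mathbb{T}_d$ with transition probabilities $\mathbf{P}_\omega(X_{n+1}=y\mid X_n=x)=\omega(x,y)$. Its law when started at $x$ (i.e. $X_0=x$), on $(\mathbb{T}_d)^{\mathbb{N}_0}$ with $\mathbb{N}_0=\{0,1,2,\dots\}$ and the $\sigma$-algebra $\mathcal{G}$ generated by cylinder sets, is the quenched law $\mathbf{P}_\omega^x$. The annealed measure $\mathbb{P}^x$ on $\Omega\times(\mathbb{T}_d)^{\mathbb{N}_0}$ is defined by $\mathbb{P}^x(A\times B)=\int_A\mathbf{P}_\omega^x(B)\,P(d\omega)$ for $A\in\mathcal{F}$, $B\in\mathcal{G}$; its marginal on $(\mathbb{T}_d)^{\mathbb{N}_0}$ is also denoted $\mathbb{P}^x$. *)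

theory Defs
  imports "HOL-Probability.Probability" "HOL-Algebra.Elementary_Groups"
begin

section \<open>Free products and the Cayley tree\<close>

text \<open>
  A group is the (internal) free product of a family of subgroups if every element has a unique
  representation as a reduced word: a product of nontrivial elements of the factors in which
  consecutive syllables come from different factors.
\<close>

definition reduced_words ::
  "('g, 'm) monoid_scheme \<Rightarrow> 'i set \<Rightarrow> ('i \<Rightarrow> 'g set) \<Rightarrow> ('i \<times> 'g) list set" where
  "reduced_words G I K =
     {w. (\<forall>(i, g) \<in> set w. i \<in> I \<and> g \<in> K i \<and> g \<noteq> \<one>\<^bsub>G\<^esub>) \<and> distinct_adj (map fst w)}"

definition word_value :: "('g, 'm) monoid_scheme \<Rightarrow> ('i \<times> 'g) list \<Rightarrow> 'g" where
  "word_value G w = foldr (\<lambda>(i, g) y. g \<otimes>\<^bsub>G\<^esub> y) w \<one>\<^bsub>G\<^esub>"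

definition is_free_product ::
  "('g, 'm) monoid_scheme \<Rightarrow> 'i set \<Rightarrow> ('i \<Rightarrow> 'g set) \<Rightarrow> bool" where
  "is_free_product G I K \<longleftrightarrow>
     group G \<and> (\<forall>i\<in>I. subgroup (K i) G) \<and>
     (\<forall>x\<in>carrier G. \<exists>!w. w \<in> reduced_words G I K \<and> word_value G w = x)"

text \<open>The free product of \<open>k\<close> infinite cyclic groups generated by \<open>a 0, \<dots>, a (k - 1)\<close> and \<open>r\<close>
  groups of order two generated by \<open>b 0, \<dots>, b (r - 1)\<close>.\<close>

definition free_product_Z_Z2 ::
  "('g, 'm) monoid_scheme \<Rightarrow> nat \<Rightarrow> nat \<Rightarrow> (nat \<Rightarrow> 'g) \<Rightarrow> (nat \<Rightarrow> 'g) \<Rightarrow> bool" where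
  "free_product_Z_Z2 G k r a b \<longleftrightarrow>
     (\<forall>i<k. a i \<in> carrier G \<and> subgroup_generated G {a i} \<cong> integer_group) \<and>
     (\<forall>j<r. b j \<in> carrier G \<and> subgroup_generated G {b j} \<cong> integer_mod_group 2) \<and>
     is_free_product G ({..<k} <+> {..<r})
       (case_sum (\<lambda>i. carrier (subgroup_generated G {a i}))
                 (\<lambda>j. carrier (subgroup_generated G {b j})))"

definition gen_set ::
  "('g, 'm) monoid_scheme \<Rightarrow> nat \<Rightarrow> nat \<Rightarrow> (nat \<Rightarrow> 'g) \<Rightarrow> (nat \<Rightarrow> 'g) \<Rightarrow> 'g set" where
  "gen_set G k r a b = a ` {..<k} \<union> (\<lambda>i. inv\<^bsub>G\<^esub> a i) ` {..<k} \<union> b ` {..<r}"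

definition neighbors :: "('g, 'm) monoid_scheme \<Rightarrow> 'g set \<Rightarrow> 'g \<Rightarrow> 'g set" where
  "neighbors G S x = {y \<in> carrier G. y \<otimes>\<^bsub>G\<^esub> inv\<^bsub>G\<^esub> x \<in> S}"

definition cayley_path :: "('g, 'm) monoid_scheme \<Rightarrow> 'g set \<Rightarrow> 'g \<Rightarrow> 'g list \<Rightarrow> 'g \<Rightarrow> bool" where
  "cayley_path G S x p y \<longleftrightarrow>
     p \<noteq> [] \<and> hd p = x \<and> last p = y \<and> set p \<subseteq> carrier G \<and> distinct p \<and>
     successively (\<lambda>u v. v \<in> neighbors G S u) p"

text \<open>The level \<open>|x|\<close>. A path is given by its list of vertices, so its length is one less than the
  length of the list.\<close>

definition level :: "('g, 'm) monoid_scheme \<Rightarrow> 'g set \<Rightarrow> 'g \<Rightarrow> nat" where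
  "level G S x = length (THE p. cayley_path G S \<one>\<^bsub>G\<^esub> p x) - 1"

definition translation :: "('g, 'm) monoid_scheme \<Rightarrow> 'g \<Rightarrow> 'g \<Rightarrow> 'g" where
  "translation G x y = y \<otimes>\<^bsub>G\<^esub> x"


section \<open>Environments\<close>

definition polish_topology :: "'a topology \<Rightarrow> bool" where
  "polish_topology T \<longleftrightarrow> completely_metrizable_space T \<and> second_countable T"

definition borel_of_topology :: "'a topology \<Rightarrow> 'a measure" where
  "borel_of_topology T = sigma (topspace T) {U. openin T U}"

text \<open>
  The collection of transition laws at the root is the underlying set of a topology \<open>T\<close> on the
  type of probability mass functions. The topology is an arbitrary Polish one subject only to
  Borel measurability of the evaluation maps.
\<close>

definition transition_laws :: "'g set \<Rightarrow> 'g pmf topology \<Rightarrow> bool" where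
  "transition_laws S T \<longleftrightarrow>
     polish_topology T \<and> (\<forall>p\<in>topspace T. set_pmf p \<subseteq> S) \<and>
     (\<forall>s\<in>S. (\<lambda>p. pmf p s) \<in> borel_measurable (borel_of_topology T))"

text \<open>The laws at \<open>x\<close> carry the topology transported along the bijection
  \<open>map_pmf (translation G x)\<close>; its open sets are the images of the open sets of \<open>T\<close>.\<close>

definition laws_at ::
  "('g, 'm) monoid_scheme \<Rightarrow> 'g pmf topology \<Rightarrow> 'g \<Rightarrow> 'g pmf measure" where
  "laws_at G T x =
     sigma (map_pmf (translation G x) ` topspace T)
           ((\<lambda>U. map_pmf (translation G x) ` U) ` {U. openin T U})"

definition env_space ::
  "('g, 'm) monoid_scheme \<Rightarrow> 'g pmf topology \<Rightarrow> ('g \<Rightarrow> 'g pmf) measure" where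
  "env_space G T = (\<Pi>\<^sub>M x\<in>carrier G. laws_at G T x)"

text \<open>The induced translation of environments,
  \<open>(\<theta>\<^sub>x \<omega>)(y, z) = \<omega>(y x\<^sup>-\<^sup>1, z x\<^sup>-\<^sup>1)\<close>.\<close>

definition env_shift ::
  "('g, 'm) monoid_scheme \<Rightarrow> 'g \<Rightarrow> ('g \<Rightarrow> 'g pmf) \<Rightarrow> ('g \<Rightarrow> 'g pmf)" where
  "env_shift G x \<omega> =
     (\<lambda>y\<in>carrier G. map_pmf (translation G x) (\<omega> (y \<otimes>\<^bsub>G\<^esub> inv\<^bsub>G\<^esub> x)))"

definition env_distribution ::
  "('g, 'm) monoid_scheme \<Rightarrow> 'g pmf topology \<Rightarrow> ('g \<Rightarrow> 'g pmf) measure \<Rightarrow> bool" where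
  "env_distribution G T P \<longleftrightarrow> prob_space P \<and> sets P = sets (env_space G T)"

definition iid_environment ::
  "('g, 'm) monoid_scheme \<Rightarrow> 'g pmf topology \<Rightarrow> ('g \<Rightarrow> 'g pmf) measure \<Rightarrow> bool" where
  "iid_environment G T P \<longleftrightarrow>
     prob_space.indep_vars P (laws_at G T) (\<lambda>x \<omega>. \<omega> x) (carrier G) \<and>
     (\<forall>x\<in>carrier G. distr P (env_space G T) (env_shift G x) = P)"


section \<open>The random walk\<close>

definition traj_space :: "('g, 'm) monoid_scheme \<Rightarrow> (nat \<Rightarrow> 'g) measure" where
  "traj_space G = (\<Pi>\<^sub>M n\<in>UNIV. count_space (carrier G))"

text \<open>The law of \<open>X\<^sub>n\<close> given the past \<open>(X\<^sub>0, \<dots>, X\<^sub>n\<^sub>-\<^sub>1) = h\<close>.\<close>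

definition walk_kernel ::
  "('g, 'm) monoid_scheme \<Rightarrow> ('g \<Rightarrow> 'g pmf) \<Rightarrow> 'g \<Rightarrow> nat \<Rightarrow> (nat \<Rightarrow> 'g) \<Rightarrow> 'g measure" where
  "walk_kernel G \<omega> x n h =
     (case n of 0 \<Rightarrow> return (count_space (carrier G)) x
              | Suc m \<Rightarrow> restrict_space (measure_pmf (\<omega> (h m))) (carrier G))"

text \<open>The quenched law is the Ionescu-Tulcea limit of these kernels.\<close>

definition quenched_law ::
  "('g, 'm) monoid_scheme \<Rightarrow> ('g \<Rightarrow> 'g pmf) \<Rightarrow> 'g \<Rightarrow> (nat \<Rightarrow> 'g) measure" where
  "quenched_law G \<omega> x =
     projective_family.lim UNIV
       (Ionescu_Tulcea.CI (walk_kernel G \<omega> x) (\<lambda>_. count_space (carrier G)))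
       (\<lambda>_. count_space (carrier G))"

definition annealed_law ::
  "('g, 'm) monoid_scheme \<Rightarrow> ('g \<Rightarrow> 'g pmf) measure \<Rightarrow> 'g \<Rightarrow>
   (('g \<Rightarrow> 'g pmf) \<times> (nat \<Rightarrow> 'g)) measure" where
  "annealed_law G P x =
     P \<bind> (\<lambda>\<omega>. distr (quenched_law G \<omega> x) (P \<Otimes>\<^sub>M traj_space G) (\<lambda>X. (\<omega>, X)))"


section \<open>Well-definedness\<close>

text \<open>
  The shift of environments is measurable, the quenched law is the law of the Markov chain with
  transition probabilities \<open>\<omega>(x, y)\<close>, and the annealed law has the value
  \<open>\<integral>\<^sub>A P\<^sub>\<omega>(B) dP\<close> on measurable rectangles.
\<close>

lemma laws_at_support:
  assumes G: "group G" and S: "S \<subseteq> carrier G" and T: "transition_laws S T"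
    and x: "x \<in> carrier G" and p: "p \<in> space (laws_at G T x)"
  shows "set_pmf p \<subseteq> carrier G"
proof -
  interpret group G by fact
  have "space (laws_at G T x) = map_pmf (translation G x) ` topspace T"
    unfolding laws_at_def by (rule space_measure_of) (auto dest: openin_subset)
  with p obtain q where "q \<in> topspace T" "p = map_pmf (translation G x) q" by auto
  with T S x show ?thesis
    by (auto simp: transition_laws_def translation_def)
qed

lemma walk_kernel_Ionescu_Tulcea:
  assumes supp: "\<And>y. y \<in> carrier G \<Longrightarrow> set_pmf (\<omega> y) \<subseteq> carrier G" and x: "x \<in> carrier G"
  shows "Ionescu_Tulcea (walk_kernel G \<omega> x) (\<lambda>_. count_space (carrier G))"
proof -
  have prob: "prob_space (restrict_space (measure_pmf (\<omega> y)) (carrier G))"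
    if "y \<in> carrier G" for y
    using supp[OF that]
    by (intro prob_spaceI)
       (simp add: emeasure_restrict_space space_restrict_space measure_pmf.emeasure_eq_1_AE
          AE_measure_pmf_iff subset_eq)
  have sets: "sets (restrict_space (measure_pmf p) (carrier G)) = sets (count_space (carrier G))" for p
    by (auto simp: sets_restrict_space)
  have m: "(\<lambda>y. restrict_space (measure_pmf (\<omega> y)) (carrier G))
      \<in> count_space (carrier G) \<rightarrow>\<^sub>M subprob_algebra (count_space (carrier G))"
    using prob sets by (auto simp: space_subprob_algebra prob_space_imp_subprob_space)
  show ?thesis
  proof (rule Ionescu_Tulcea.intro, goal_cases)
    case (1 n) show ?case
    proof (cases n)
      case 0 then show ?thesis using x
        by (auto simp: walk_kernel_def[abs_def] space_subprob_algebra
              intro!: measurable_const prob_space_imp_subprob_space prob_space_return)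
    next
      case (Suc m)
      have "(\<lambda>h. h m) \<in> (\<Pi>\<^sub>M i\<in>{0..<n}. count_space (carrier G)) \<rightarrow>\<^sub>M count_space (carrier G)"
        by (rule measurable_component_singleton) (simp add: Suc)
      from measurable_compose[OF this m] show ?thesis
        by (simp add: walk_kernel_def[abs_def] Suc)
    qed
  next
    case (2 n h)
    then show ?case
      using prob x by (cases n) (auto simp: walk_kernel_def space_PiM PiE_iff prob_space_return)
  qed
qed

lemma
  assumes supp: "\<And>y. y \<in> carrier G \<Longrightarrow> set_pmf (\<omega> y) \<subseteq> carrier G" and x: "x \<in> carrier G"
  shows sets_quenched_law: "sets (quenched_law G \<omega> x) = sets (traj_space G)"
    and prob_space_quenched_law: "prob_space (quenched_law G \<omega> x)"
    and emeasure_quenched_law_cylinder: "\<And>n p. p \<in> {..n} \<rightarrow> carrier G \<Longrightarrow>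
      emeasure (quenched_law G \<omega> x) {X \<in> space (traj_space G). \<forall>i\<le>n. X i = p i} =
      ennreal (indicator {x} (p 0) * (\<Prod>i<n. pmf (\<omega> (p i)) (p (Suc i))))"
proof -
  define M where "M = (\<lambda>_::nat. count_space (carrier G))"
  interpret IT: Ionescu_Tulcea "walk_kernel G \<omega> x" M
    unfolding M_def by (rule walk_kernel_Ionescu_Tulcea[OF supp x])
  have Q: "quenched_law G \<omega> x = IT.PF.lim"
    by (simp add: quenched_law_def M_def)
  have setsQ: "sets (quenched_law G \<omega> x) = sets (PiM UNIV M)"
    unfolding Q by (rule IT.PF.sets_lim)
  then show "sets (quenched_law G \<omega> x) = sets (traj_space G)"
    by (simp add: traj_space_def M_def)
  note spQ = sets_eq_imp_space_eq[OF setsQ]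
  show "prob_space (quenched_law G \<omega> x)"
  proof (rule prob_spaceI)
    have "emeasure IT.PF.lim (prod_emb UNIV M {} (space (PiM {} M))) = emeasure (IT.CI {}) (space (PiM {} M))"
      by (rule IT.lim) auto
    also have "\<dots> = 1"
      using prob_space.emeasure_space_1[OF IT.PF.prob_space_P[of "{}"]] by (simp add: IT.PF.space_P)
    also have "prod_emb UNIV M {} (space (PiM {} M)) = space (quenched_law G \<omega> x)"
      by (auto simp: spQ prod_emb_def space_PiM)
    finally show "emeasure (quenched_law G \<omega> x) (space (quenched_law G \<omega> x)) = 1" by (simp only: Q)
  qed
  fix n :: nat and p assume p: "p \<in> {..n} \<rightarrow> carrier G"
  let ?pt = "\<lambda>n. {restrict p {0..<n}}"
  have pt_space: "restrict p {0..<m} \<in> space (PiM {0..<m} M)" if "m \<le> Suc n" for m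
    using that p by (auto simp: space_PiM M_def)
  have pt_sets: "?pt m \<in> sets (PiM {0..<m} M)" if "m \<le> Suc n" for m
  proof -
    have "?pt m = (\<Pi>\<^sub>E i\<in>{0..<m}. {p i})"
      by (auto simp: PiE_iff fun_eq_iff extensional_def)
    also have "\<dots> \<in> sets (PiM {0..<m} M)"
      using that p by (intro sets_PiM_I_finite) (auto simp: M_def)
    finally show ?thesis .
  qed
  have C: "emeasure (IT.C 0 (Suc m) (\<lambda>_. undefined)) (?pt (Suc m)) =
      emeasure (walk_kernel G \<omega> x m (restrict p {0..<m})) {p m} *
      emeasure (IT.C 0 m (\<lambda>_. undefined)) (?pt m)" if m: "m \<le> n" for m
  proof -
    have u: "(\<lambda>_. undefined) \<in> space (PiM {0..<0} M)" by (simp add: space_PiM)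
    have eP: "emeasure (IT.eP m h) (?pt (Suc m)) =
        emeasure (walk_kernel G \<omega> x m (restrict p {0..<m})) {p m} * indicator (?pt m) h"
      if h: "h \<in> space (PiM {0..<m} M)" for h
    proof -
      have "(\<lambda>y. h(m := y)) -` ?pt (Suc m) \<inter> space (M m) =
          (if h = restrict p {0..<m} then {p m} else {})"
      proof -
        have "h(m := y) = restrict p {0..<Suc m} \<longleftrightarrow> h = restrict p {0..<m} \<and> y = p m" for y
        proof
          assume eq: "h(m := y) = restrict p {0..<Suc m}"
          have "h i = restrict p {0..<m} i" for i
            using fun_cong[OF eq, of i] h
            by (cases "i = m") (auto simp: space_PiM PiE_iff extensional_def less_Suc_eq split: if_splits)
          then show "h = restrict p {0..<m} \<and> y = p m"
            using fun_cong[OF eq, of m] by auto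
        qed (auto simp: fun_eq_iff)
        with m p show ?thesis by (auto simp: M_def simp del: fun_upd_restrict_conv restrict_fupd restrict_upd)
      qed
      then show ?thesis
        using m by (subst IT.emeasure_eP[OF h pt_sets]) (auto)
    qed
    have "emeasure (IT.C 0 (Suc m) (\<lambda>_. undefined)) (?pt (Suc m)) =
        (\<integral>\<^sup>+h. emeasure (IT.eP m h) (?pt (Suc m)) \<partial>IT.C 0 m (\<lambda>_. undefined))"
      using m u IT.space_C[OF u, of m] pt_sets[of "Suc m"] pt_space[of m]
      apply simp
      apply (rule emeasure_bind[where N="PiM {0..<Suc m} M"])
        apply force
       apply (subst measurable_cong_sets[OF IT.sets_C[OF u] refl])
       apply (simp)
      apply simp
      done
    also have "\<dots> = (\<integral>\<^sup>+h. emeasure (walk_kernel G \<omega> x m (restrict p {0..<m})) {p m} * indicator (?pt m) h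
        \<partial>IT.C 0 m (\<lambda>_. undefined))"
      using IT.space_C[OF u, of m] by (intro nn_integral_cong eP) simp
    also have "\<dots> = emeasure (walk_kernel G \<omega> x m (restrict p {0..<m})) {p m} *
        emeasure (IT.C 0 m (\<lambda>_. undefined)) (?pt m)"
      using m pt_sets[of m] by (intro nn_integral_cmult_indicator) (simp add: IT.sets_C[OF u])
    finally show ?thesis .
  qed
  have C': "emeasure (IT.C 0 (Suc m) (\<lambda>_. undefined)) (?pt (Suc m)) =
      ennreal (indicator {x} (p 0) * (\<Prod>i<m. pmf (\<omega> (p i)) (p (Suc i))))" if "m \<le> n" for m
    using that
  proof (induction m)
    case 0
    have "emeasure (IT.C 0 0 (\<lambda>_. undefined)) (?pt 0) = 1" by (simp add: PiM_empty restrict_def)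
    with 0 p show ?case
      by (subst C) (auto simp: walk_kernel_def Pi_iff indicator_def simp del: IT.C.simps)
  next
    case (Suc m)
    have "emeasure (walk_kernel G \<omega> x (Suc m) (restrict p {0..<Suc m})) {p (Suc m)} =
        ennreal (pmf (\<omega> (p m)) (p (Suc m)))"
      using p Suc.prems
      by (auto simp: walk_kernel_def emeasure_restrict_space emeasure_pmf_single Pi_iff)
    moreover have "emeasure (IT.C 0 (Suc m) (\<lambda>_. undefined)) (?pt (Suc m)) =
        ennreal (indicator {x} (p 0) * (\<Prod>i<m. pmf (\<omega> (p i)) (p (Suc i))))"
      by (rule Suc.IH) (use Suc.prems in simp)
    ultimately show ?case
      using Suc.prems by (simp only: C) (simp add: ennreal_mult' [symmetric] prod_nonneg mult_ac)
  qed
  have "{X \<in> space (traj_space G). \<forall>i\<le>n. X i = p i} = prod_emb UNIV M {0..<Suc n} (?pt (Suc n))"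
  proof -
    have "restrict X A = restrict p A \<longleftrightarrow> (\<forall>i\<in>A. X i = p i)" for X A
      by (metis restrict_apply' restrict_ext)
    then show ?thesis by (auto simp: traj_space_def M_def prod_emb_def space_PiM)
  qed
  also have "emeasure (quenched_law G \<omega> x) \<dots> = emeasure (IT.CI {0..<Suc n}) (?pt (Suc n))"
    unfolding Q by (rule IT.lim) (use pt_sets in auto)
  also have "\<dots> = emeasure (IT.C 0 (Suc n) (\<lambda>_. undefined))
      (prod_emb {0..<Suc n} M {0..<Suc n} (?pt (Suc n)))"
    by (rule IT.emeasure_CI) (use pt_sets in auto)
  also have "prod_emb {0..<Suc n} M {0..<Suc n} (?pt (Suc n)) = ?pt (Suc n)"
    by (rule prod_emb_id[OF sets.sets_into_space[OF pt_sets[OF order_refl], unfolded space_PiM]])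
  also note C'[OF order_refl]
  finally show "emeasure (quenched_law G \<omega> x) {X \<in> space (traj_space G). \<forall>i\<le>n. X i = p i} =
      ennreal (indicator {x} (p 0) * (\<Prod>i<n. pmf (\<omega> (p i)) (p (Suc i))))" .
qed

lemma measurable_pmf_laws_at:
  assumes G: "group G" and S: "S \<subseteq> carrier G" and T: "transition_laws S T"
    and x: "x \<in> carrier G" and y: "y \<in> carrier G"
  shows "(\<lambda>p. pmf p y) \<in> borel_measurable (laws_at G T x)"
proof -
  interpret group G by fact
  let ?f = "map_pmf (translation G x)"
  let ?z = "y \<otimes>\<^bsub>G\<^esub> inv\<^bsub>G\<^esub> x"
  let ?g = "\<lambda>p. map_pmf (translation G (inv\<^bsub>G\<^esub> x)) p"
  have supp: "set_pmf q \<subseteq> carrier G" if "q \<in> topspace T" for q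
    using that T S by (auto simp: transition_laws_def)
  have inverse: "?g (?f q) = q" if "q \<in> topspace T" for q
  proof -
    have "map_pmf (\<lambda>u. translation G (inv\<^bsub>G\<^esub> x) (translation G x u)) q = map_pmf id q"
      using supp[OF that] x by (intro map_pmf_cong) (auto simp: translation_def m_assoc subset_eq)
    then show ?thesis by (simp add: pmf.map_comp o_def)
  qed
  have gens: "(\<lambda>U. ?f ` U) ` {U. openin T U} \<subseteq> Pow (?f ` topspace T)"
    by (auto dest: openin_subset)
  have space: "space (laws_at G T x) = ?f ` topspace T"
    unfolding laws_at_def using gens by (rule space_measure_of)
  have space': "space (borel_of_topology T) = topspace T"
    unfolding borel_of_topology_def by (rule space_measure_of) (auto dest: openin_subset)
  have g: "?g \<in> laws_at G T x \<rightarrow>\<^sub>M borel_of_topology T"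
    unfolding borel_of_topology_def
  proof (rule measurable_measure_of)
    show "{U. openin T U} \<subseteq> Pow (topspace T)" by (auto dest: openin_subset)
    show "?g \<in> space (laws_at G T x) \<rightarrow> topspace T" by (auto simp: space inverse)
    fix U assume "U \<in> {U. openin T U}"
    then have U: "openin T U" by simp
    have "?g -` U \<inter> space (laws_at G T x) = ?f ` U"
      using openin_subset[OF U] by (auto simp: space inverse subset_eq)
    also have "\<dots> \<in> sets (laws_at G T x)"
      using U gens by (auto simp: laws_at_def)
    finally show "?g -` U \<inter> space (laws_at G T x) \<in> sets (laws_at G T x)" .
  qed
  have z: "pmf (?f q) y = pmf q ?z" if q: "q \<in> topspace T" for q
  proof -
    have "measure (measure_pmf q) (translation G x -` {y}) = measure (measure_pmf q) {?z}"
      using supp[OF q] x y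
      by (intro measure_pmf.finite_measure_eq_AE)
         (auto simp: AE_measure_pmf_iff translation_def m_assoc subset_eq)
    then show ?thesis by (simp add: pmf_map measure_pmf_single)
  qed
  have ev: "(\<lambda>q. pmf q ?z) \<in> borel_measurable (borel_of_topology T)"
  proof (cases "?z \<in> S")
    case True then show ?thesis using T by (simp add: transition_laws_def)
  next
    case False
    have "pmf q ?z = 0" if "q \<in> space (borel_of_topology T)" for q
      using that False T by (auto simp: space' transition_laws_def pmf_eq_0_set_pmf)
    then show ?thesis by (subst measurable_cong[where g="\<lambda>_. 0"]) auto
  qed
  have "(\<lambda>p. pmf (?g p) ?z) \<in> borel_measurable (laws_at G T x)"
    by (rule measurable_compose[OF g ev])
  then show ?thesis
    by (rule measurable_cong[THEN iffD1, rotated]) (auto simp: space inverse z)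
qed

lemma sets_traj_space_cylinders:
  assumes "countable (carrier G)"
  shows "sets (traj_space G) = sigma_sets (space (traj_space G))
    (insert {} {{X \<in> space (traj_space G). \<forall>i\<le>n. X i = p i} | n p. p \<in> {..n} \<rightarrow> carrier G})"
    (is "_ = sigma_sets ?\<Omega> ?G")
proof
  have sp: "?\<Omega> = UNIV \<rightarrow> carrier G" by (auto simp: traj_space_def space_PiM)
  have comp: "{X \<in> ?\<Omega>. X i = y} \<in> sigma_sets ?\<Omega> ?G" if y: "y \<in> carrier G" for i :: nat and y
  proof -
    let ?I = "{p \<in> {..i} \<rightarrow>\<^sub>E carrier G. p i = y}"
    have c: "countable ?I"
      by (rule countable_subset[of _ "{..i} \<rightarrow>\<^sub>E carrier G"]) (auto intro!: countable_PiE assms)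
    have "{X \<in> ?\<Omega>. X i = y} = (\<Union>p\<in>?I. {X \<in> ?\<Omega>. \<forall>j\<le>i. X j = p j})"
    proof safe
      fix X assume "X \<in> ?\<Omega>" "y = X i"
      then show "X \<in> (\<Union>p\<in>{p \<in> {..i} \<rightarrow>\<^sub>E carrier G. p i = X i}. {X \<in> ?\<Omega>. \<forall>j\<le>i. X j = p j})"
        by (intro UN_I[of "restrict X {..i}"]) (auto simp: sp)
    qed auto
    also have "\<dots> \<in> sigma_sets ?\<Omega> ?G"
    proof (rule sigma_sets_UNION)
      show "countable ((\<lambda>p. {X \<in> ?\<Omega>. \<forall>j\<le>i. X j = p j}) ` ?I)"
        using c by (rule countable_image)
      fix B assume "B \<in> (\<lambda>p. {X \<in> ?\<Omega>. \<forall>j\<le>i. X j = p j}) ` ?I"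
      then obtain p where "p \<in> {..i} \<rightarrow> carrier G" "B = {X \<in> ?\<Omega>. \<forall>j\<le>i. X j = p j}"
        by (auto simp: PiE_iff Pi_iff)
      then show "B \<in> sigma_sets ?\<Omega> ?G"
        by (intro sigma_sets.Basic) blast
    qed
    finally show ?thesis .
  qed
  define N where "N = sigma ?\<Omega> ?G"
  have N: "sets N = sigma_sets ?\<Omega> ?G" "space N = ?\<Omega>"
    by (auto simp: N_def intro!: sets_measure_of space_measure_of)
  have "(\<lambda>X i. X i) \<in> N \<rightarrow>\<^sub>M traj_space G"
    unfolding traj_space_def
  proof (rule measurable_PiM_single', goal_cases)
    case (1 i)
    show ?case
      unfolding measurable_count_space_eq_countable[OF assms]
    proof (intro conjI ballI Pi_I)
      show "X i \<in> carrier G" if "X \<in> space N" for X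
        using that unfolding N(2) by (auto simp: sp)
      fix y assume "y \<in> carrier G"
      from comp[OF this, of i] show "(\<lambda>X. X i) -` {y} \<inter> space N \<in> sets N"
        unfolding N by (simp add: vimage_def Int_def conj_commute)
    qed
  next
    case 2
    show ?case unfolding N(2) by (auto simp: sp)
  qed
  then have id: "(\<lambda>X. X) \<in> N \<rightarrow>\<^sub>M traj_space G" by simp
  show "sets (traj_space G) \<subseteq> sigma_sets ?\<Omega> ?G"
  proof
    fix A assume A: "A \<in> sets (traj_space G)"
    have "(\<lambda>X. X) -` A \<inter> space N = A"
      using sets.sets_into_space[OF A] unfolding N(2) by (simp add: Int_absorb2)
    with measurable_sets[OF id A] show "A \<in> sigma_sets ?\<Omega> ?G"
      unfolding N(1) by (simp only:)
  qed
  have "{X \<in> ?\<Omega>. \<forall>i\<le>n. X i = p i} \<in> sets (traj_space G)" if "p \<in> {..n} \<rightarrow> carrier G" for n p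
  proof -
    have "{X \<in> ?\<Omega>. \<forall>i\<le>n. X i = p i} = prod_emb UNIV (\<lambda>_. count_space (carrier G)) {..n} (\<Pi>\<^sub>E i\<in>{..n}. {p i})"
      by (auto simp: prod_emb_def traj_space_def space_PiM PiE_iff)
    also have "\<dots> \<in> sets (traj_space G)"
      unfolding traj_space_def using that by (intro sets_PiM_I) auto
    finally show ?thesis .
  qed
  then have "?G \<subseteq> sets (traj_space G)" by blast
  then show "sigma_sets ?\<Omega> ?G \<subseteq> sets (traj_space G)"
    by (rule sets.sigma_sets_subset)
qed

lemma measurable_quenched_law:
  assumes G: "group G" and c: "countable (carrier G)" and S: "S \<subseteq> carrier G"
    and T: "transition_laws S T" and P: "sets P = sets (env_space G T)" and x: "x \<in> carrier G"
  shows "(\<lambda>\<omega>. quenched_law G \<omega> x) \<in> P \<rightarrow>\<^sub>M prob_algebra (traj_space G)"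
proof -
  have supp: "set_pmf (\<omega> y) \<subseteq> carrier G" if "\<omega> \<in> space P" "y \<in> carrier G" for \<omega> y
    using that sets_eq_imp_space_eq[OF P]
    by (intro laws_at_support[OF G S T that(2)]) (auto simp: env_space_def space_PiM)
  have ev: "(\<lambda>\<omega>. pmf (\<omega> y) z) \<in> borel_measurable P" if "y \<in> carrier G" "z \<in> carrier G" for y z
  proof -
    have "(\<lambda>\<omega>. \<omega> y) \<in> P \<rightarrow>\<^sub>M laws_at G T y"
      unfolding measurable_cong_sets[OF P refl] env_space_def
      using that by (intro measurable_component_singleton)
    from measurable_compose[OF this measurable_pmf_laws_at[OF G S T that]] show ?thesis .
  qed
  show ?thesis
  proof (rule measurable_prob_algebra_generated[OF sets_traj_space_cylinders[OF c]])
    let ?G = "insert {} {{X \<in> space (traj_space G). \<forall>i\<le>n. X i = p i} | n p. p \<in> {..n} \<rightarrow> carrier G}"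
    have aux: "{X \<in> space (traj_space G). \<forall>i\<le>n. X i = p i} \<inter> {X \<in> space (traj_space G). \<forall>i\<le>m. X i = q i} \<in> ?G"
      if pq: "p \<in> {..n} \<rightarrow> carrier G" "q \<in> {..m} \<rightarrow> carrier G" for n m :: nat and p q
    proof (cases "\<forall>i\<le>min n m. p i = q i")
      case True
      define r where "r i = (if i \<le> n then p i else q i)" for i
      have "{X \<in> space (traj_space G). \<forall>i\<le>n. X i = p i} \<inter> {X \<in> space (traj_space G). \<forall>i\<le>m. X i = q i} =
          {X \<in> space (traj_space G). \<forall>i\<le>max n m. X i = r i}"
        using True by (auto simp: r_def min_def max_def split: if_splits)
      moreover have "r \<in> {..max n m} \<rightarrow> carrier G"
        using pq by (auto simp: r_def Pi_iff)
      ultimately show ?thesis by blast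
    next
      case False
      then have "{X \<in> space (traj_space G). \<forall>i\<le>n. X i = p i} \<inter> {X \<in> space (traj_space G). \<forall>i\<le>m. X i = q i} = {}"
        by auto
      then show ?thesis by simp
    qed
    then show "Int_stable ?G"
      by (intro Int_stableI) (elim insertE CollectE exE conjE; simp)
    show "?G \<subseteq> Pow (space (traj_space G))" by auto
    fix \<omega> assume "\<omega> \<in> space P"
    then show "prob_space (quenched_law G \<omega> x)" "sets (quenched_law G \<omega> x) = sets (traj_space G)"
      using supp x by (auto intro!: prob_space_quenched_law sets_quenched_law)
  next
    fix A assume "A \<in> insert {} {{X \<in> space (traj_space G). \<forall>i\<le>n. X i = p i} | n p. p \<in> {..n} \<rightarrow> carrier G}"
    then consider "A = {}" | n p where "p \<in> {..n} \<rightarrow> carrier G"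
        "A = {X \<in> space (traj_space G). \<forall>i\<le>n. X i = p i}" by blast
    then show "(\<lambda>\<omega>. emeasure (quenched_law G \<omega> x) A) \<in> borel_measurable P"
    proof cases
      case 2
      have "(\<lambda>\<omega>. ennreal (indicator {x} (p 0) * (\<Prod>i<n. pmf (\<omega> (p i)) (p (Suc i))))) \<in> borel_measurable P"
        using 2(1) by (intro measurable_compose[OF _ measurable_ennreal] borel_measurable_times
            borel_measurable_prod ev) (auto simp: Pi_iff)
      then show ?thesis
        by (rule measurable_cong[THEN iffD1, rotated])
           (use 2 supp x in \<open>simp add: emeasure_quenched_law_cylinder\<close>)
    qed simp
  qed
qed

lemma
  assumes G: "group G" and c: "countable (carrier G)" and S: "S \<subseteq> carrier G"
    and T: "transition_laws S T" and P: "env_distribution G T P" and x: "x \<in> carrier G"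
  shows sets_annealed_law: "sets (annealed_law G P x) = sets (P \<Otimes>\<^sub>M traj_space G)"
    and prob_space_annealed_law: "prob_space (annealed_law G P x)"
    and emeasure_annealed_law_Times: "\<And>A B. A \<in> sets P \<Longrightarrow> B \<in> sets (traj_space G) \<Longrightarrow>
      emeasure (annealed_law G P x) (A \<times> B) = (\<integral>\<^sup>+\<omega>\<in>A. emeasure (quenched_law G \<omega> x) B \<partial>P)"
proof -
  interpret prob_space P using P by (simp add: env_distribution_def)
  have Ps: "sets P = sets (env_space G T)" using P by (simp add: env_distribution_def)
  have Q: "(\<lambda>\<omega>. quenched_law G \<omega> x) \<in> P \<rightarrow>\<^sub>M prob_algebra (traj_space G)"
    by (rule measurable_quenched_law[OF G c S T Ps x])
  note Q' = measurable_prob_algebraD[OF Q]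
  have sQ: "sets (quenched_law G \<omega> x) = sets (traj_space G)" if "\<omega> \<in> space P" for \<omega>
    using measurable_space[OF Q that] by (simp add: space_prob_algebra)
  note spQ = sets_eq_imp_space_eq[OF sQ]
  let ?K = "\<lambda>\<omega>. distr (quenched_law G \<omega> x) (P \<Otimes>\<^sub>M traj_space G) (\<lambda>X. (\<omega>, X))"
  have K: "?K \<in> P \<rightarrow>\<^sub>M prob_algebra (P \<Otimes>\<^sub>M traj_space G)"
    by (rule measurable_distr_prob_space2[OF Q]) measurable
  note K' = measurable_prob_algebraD[OF K]
  show "sets (annealed_law G P x) = sets (P \<Otimes>\<^sub>M traj_space G)"
    unfolding annealed_law_def using not_empty by (intro sets_bind) auto
  show "prob_space (annealed_law G P x)"
    unfolding annealed_law_def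
    using measurable_space[OF K] by (intro prob_space_bind[OF _ K'] AE_I2) (simp add: space_prob_algebra)
  fix A B assume A: "A \<in> sets P" and B: "B \<in> sets (traj_space G)"
  have "emeasure (annealed_law G P x) (A \<times> B) = (\<integral>\<^sup>+\<omega>. emeasure (?K \<omega>) (A \<times> B) \<partial>P)"
    unfolding annealed_law_def using A B by (intro emeasure_bind[OF not_empty K']) simp
  also have "\<dots> = (\<integral>\<^sup>+\<omega>\<in>A. emeasure (quenched_law G \<omega> x) B \<partial>P)"
  proof (rule nn_integral_cong)
    fix \<omega> assume w: "\<omega> \<in> space P"
    have m: "(\<lambda>X. (\<omega>, X)) \<in> quenched_law G \<omega> x \<rightarrow>\<^sub>M P \<Otimes>\<^sub>M traj_space G"
      unfolding measurable_cong_sets[OF sQ[OF w] refl] using w by simp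
    have "(\<lambda>X. (\<omega>, X)) -` (A \<times> B) \<inter> space (quenched_law G \<omega> x) = (if \<omega> \<in> A then B else {})"
      using sets.sets_into_space[OF B] spQ[OF w] by auto
    then show "emeasure (?K \<omega>) (A \<times> B) = emeasure (quenched_law G \<omega> x) B * indicator A \<omega>"
      using A B by (subst emeasure_distr[OF m]) auto
  qed
  finally show "emeasure (annealed_law G P x) (A \<times> B) =
      (\<integral>\<^sup>+\<omega>\<in>A. emeasure (quenched_law G \<omega> x) B \<partial>P)" .
qed

lemma countable_free_product_Z_Z2:
  assumes "free_product_Z_Z2 G k r a b"
  shows "countable (carrier G)"
proof -
  let ?K = "case_sum (\<lambda>i. carrier (subgroup_generated G {a i}))
                     (\<lambda>j. carrier (subgroup_generated G {b j}))"
  let ?I = "{..<k} <+> {..<r}"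
  have iso: "countable (carrier H)" if "H \<cong> K" for H :: "('a, 'b) monoid_scheme" and K :: "int monoid"
  proof -
    from that obtain h where "bij_betw h (carrier H) (carrier K)"
      by (auto simp: is_iso_def iso_def)
    then show ?thesis
      by (meson bij_betw_def countableI_type countable_image_inj_on)
  qed
  have "countable (\<Union>i\<in>?I. {i} \<times> ?K i)"
    using assms iso by (intro countable_UN) (auto simp: free_product_Z_Z2_def)
  then have "countable (word_value G ` lists (\<Union>i\<in>?I. {i} \<times> ?K i))"
    by (intro countable_image countable_lists)
  moreover have "carrier G \<subseteq> word_value G ` lists (\<Union>i\<in>?I. {i} \<times> ?K i)"
  proof
    fix x assume "x \<in> carrier G"
    then obtain w where "w \<in> reduced_words G ?I ?K" "word_value G w = x"
      using assms unfolding free_product_Z_Z2_def is_free_product_def by blast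
    moreover from this(1) have "w \<in> lists (\<Union>i\<in>?I. {i} \<times> ?K i)"
      by (fastforce simp: reduced_words_def in_lists_conv_set)
    ultimately show "x \<in> word_value G ` lists (\<Union>i\<in>?I. {i} \<times> ?K i)" by blast
  qed
  ultimately show ?thesis by (rule countable_subset[rotated])
qed

lemma gen_set_subset_carrier:
  assumes "free_product_Z_Z2 G k r a b"
  shows "gen_set G k r a b \<subseteq> carrier G"
proof -
  interpret group G
    using assms by (simp add: free_product_Z_Z2_def is_free_product_def)
  show ?thesis
    using assms by (auto simp: free_product_Z_Z2_def gen_set_def)
qed

lemma measurable_env_shift:
  assumes G: "group G" and S: "S \<subseteq> carrier G" and T: "transition_laws S T"
    and P: "sets P = sets (env_space G T)" and x: "x \<in> carrier G"
  shows "env_shift G x \<in> P \<rightarrow>\<^sub>M env_space G T"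
proof -
  interpret group G by fact
  let ?f = "\<lambda>x. map_pmf (translation G x)"
  have supp: "set_pmf q \<subseteq> carrier G" if "q \<in> topspace T" for q
    using that T S by (auto simp: transition_laws_def)
  have comp: "?f u (?f v q) = ?f (v \<otimes>\<^bsub>G\<^esub> u) q"
    if "q \<in> topspace T" "u \<in> carrier G" "v \<in> carrier G" for q u v
  proof -
    have "map_pmf (\<lambda>z. translation G u (translation G v z)) q = ?f (v \<otimes>\<^bsub>G\<^esub> u) q"
      using supp[OF that(1)] that(2,3)
      by (intro map_pmf_cong) (auto simp: translation_def m_assoc subset_eq)
    then show ?thesis by (simp add: pmf.map_comp o_def)
  qed
  have one: "?f \<one>\<^bsub>G\<^esub> q = q" if "q \<in> topspace T" for q
    using supp[OF that] map_pmf_cong[of q q "translation G \<one>\<^bsub>G\<^esub>" id]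
    by (auto simp: translation_def subset_eq)
  have inj: "q = q'" if "?f y q = ?f y q'" "q \<in> topspace T" "q' \<in> topspace T" "y \<in> carrier G" for q q' y
    using arg_cong[OF that(1), of "?f (inv\<^bsub>G\<^esub> y)"] that(2-) by (simp add: comp one)
  have gens: "(\<lambda>U. ?f y ` U) ` {U. openin T U} \<subseteq> Pow (?f y ` topspace T)" for y
    by (auto dest: openin_subset)
  have space: "space (laws_at G T y) = ?f y ` topspace T" for y
    unfolding laws_at_def using gens by (rule space_measure_of)
  have shift: "?f x \<in> laws_at G T (y \<otimes>\<^bsub>G\<^esub> inv\<^bsub>G\<^esub> x) \<rightarrow>\<^sub>M laws_at G T y" if y: "y \<in> carrier G" for y
  proof -
    let ?z = "y \<otimes>\<^bsub>G\<^esub> inv\<^bsub>G\<^esub> x"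
    have z: "?f x (?f ?z q) = ?f y q" if "q \<in> topspace T" for q
      using that x y by (simp add: comp m_assoc)
    show ?thesis
      unfolding laws_at_def[of G T y]
    proof (rule measurable_measure_of[OF gens])
      show "?f x \<in> space (laws_at G T ?z) \<rightarrow> ?f y ` topspace T"
        by (auto simp: space z)
      fix V assume "V \<in> (\<lambda>U. ?f y ` U) ` {U. openin T U}"
      then obtain U where U: "openin T U" "V = ?f y ` U" by auto
      have "?f x -` V \<inter> space (laws_at G T ?z) = ?f ?z ` U"
        using openin_subset[OF U(1)] by (auto simp: space z U subset_eq dest!: inj[OF _ _ _ y])
      also have "\<dots> \<in> sets (laws_at G T ?z)"
        using U gens[of ?z] by (auto simp: laws_at_def)
      finally show "?f x -` V \<inter> space (laws_at G T ?z) \<in> sets (laws_at G T ?z)" .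
    qed
  qed
  show ?thesis
    unfolding measurable_cong_sets[OF P refl] env_shift_def[abs_def] env_space_def
  proof (rule measurable_restrict)
    fix y assume y: "y \<in> carrier G"
    show "(\<lambda>\<omega>. ?f x (\<omega> (y \<otimes>\<^bsub>G\<^esub> inv\<^bsub>G\<^esub> x))) \<in> (\<Pi>\<^sub>M x\<in>carrier G. laws_at G T x) \<rightarrow>\<^sub>M laws_at G T y"
      by (rule measurable_compose[OF _ shift[OF y]], rule measurable_component_singleton) (use x y in simp)
  qed
qed

end

theory Submission
  imports Defs "HOL-Algebra.Multiplicative_Group"
begin

text \<open>
  In a \<open>d\<close>-regular tree every vertex other than the root has exactly one neighbour closer to the
  root. If each of the \<open>d - 1\<close> other neighbours is chosen with probability more than
  \<open>\<epsilon> > 1 / (2 * (d - 1))\<close>, then the walk steps back with probability at most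
  \<open>1 - (d - 1) * \<epsilon> < 1 / 2\<close>. So in almost every environment the distance to the root has a drift
  that is bounded below by a positive constant, at every vertex and whatever the past, and the walk
  escapes at a positive speed by a large deviation bound.

  Concretely, for a suitable \<open>z < 1\<close> the expectation of \<open>z ^ level G S (X n)\<close> is multiplied by at
  most some \<open>\<rho> < 1\<close> in each step (\<open>drift_exp_moment\<close>), so it is at most \<open>\<rho> ^ n\<close>
  (\<open>quenched_contraction\<close>). By the Borel-Cantelli lemma the level then grows at least linearly
  (\<open>AE_linear_growth_of_geometric_moments\<close>).

  Two further ingredients are needed. That a step changes the level as it does in a tree
  (\<open>level_neighbors\<close>) comes from the normal form in free products: every element is the value of
  exactly one reduced word in the generators (\<open>reduced_exists\<close>, \<open>reduced_unique\<close>), the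
  self-avoiding paths from the root are those traced out by reduced words, and hence the level is the
  word length. That the lower bound \<open>\<epsilon>\<close>, which is assumed at the root, holds at all vertices at
  once (\<open>AE_elliptic_everywhere\<close>) comes from the invariance of the environment under translations and
  the countability of the group. The statement for the annealed law is obtained by integrating the
  quenched one over the environments (\<open>AE_annealed_lawI\<close>).
\<close>

section \<open>Normal forms in the free product\<close>

locale Z_Z2_free_product = group G for G (structure) +
  fixes k r :: nat and a b :: "nat \<Rightarrow> 'a" and S :: "'a set"
  assumes free: "free_product_Z_Z2 G k r a b"
    and gens: "S = gen_set G k r a b"
begin

abbreviation "factors \<equiv> {..<k} <+> {..<r}"

definition factor :: "nat + nat \<Rightarrow> 'a set" where
  "factor = case_sum (\<lambda>i. carrier (subgroup_generated G {a i}))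
                     (\<lambda>j. carrier (subgroup_generated G {b j}))"

definition syllable_words :: "((nat + nat) \<times> 'a) list set" where
  "syllable_words = reduced_words G factors factor"

text \<open>A relation rather than a function from generators to indices: that a generator lies in only one
  factor is itself a consequence of the uniqueness of normal forms.\<close>

definition letter :: "nat + nat \<Rightarrow> 'a \<Rightarrow> bool" where
  "letter i s \<longleftrightarrow>
     (case i of Inl n \<Rightarrow> n < k \<and> (s = a n \<or> s = inv a n) | Inr n \<Rightarrow> n < r \<and> s = b n)"

lemma a_closed: "n < k \<Longrightarrow> a n \<in> carrier G" and b_closed: "n < r \<Longrightarrow> b n \<in> carrier G"
  using free by (auto simp: free_product_Z_Z2_def)

lemma a_int_pow_eq_one:
  assumes "n < k" "a n [^] (m::int) = \<one>"
  shows "m = 0"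
proof -
  have "infinite (carrier (subgroup_generated G {a n}))"
    using free assms(1) iso_finite[of "subgroup_generated G {a n}" integer_group]
    by (auto simp: free_product_Z_Z2_def infinite_UNIV_int)
  with infinite_cyclic_subgroup_int[OF a_closed[OF assms(1)]] assms(2) show ?thesis
    by (metis int_pow_0)
qed

lemma carrier_generated_b:
  assumes "n < r"
  shows "b n \<noteq> \<one>" "b n \<otimes> b n = \<one>" "carrier (subgroup_generated G {b n}) = {\<one>, b n}"
proof -
  let ?H = "subgroup_generated G {b n}"
  interpret H: group ?H by simp
  have "card (carrier ?H) = card {0..<2::int}"
    using free assms iso_same_card[of ?H "integer_mod_group 2"]
    by (auto simp: free_product_Z_Z2_def carrier_integer_mod_group)
  then have card: "card (carrier ?H) = 2" by simp
  note b = b_closed[OF assms]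
  have in_H: "\<one> \<in> carrier ?H" "b n \<in> carrier ?H"
    using b H.one_closed by (auto intro: generate.incl simp: carrier_subgroup_generated)
  show 1: "b n \<noteq> \<one>"
  proof
    assume "b n = \<one>"
    then have "carrier ?H = {\<one>}"
      by (simp add: carrier_subgroup_generated_by_singleton)
    with card show False by simp
  qed
  show H: "carrier ?H = {\<one>, b n}"
    by (rule card_subset_eq[symmetric]) (use in_H 1 card card_ge_0_finite[of "carrier ?H"] in auto)
  have "b n \<otimes> b n \<in> carrier ?H"
    using H.m_closed[OF in_H(2) in_H(2)] by simp
  then show "b n \<otimes> b n = \<one>"
    using H 1 b by auto
qed

lemma letter_closed: "letter i s \<Longrightarrow> s \<in> carrier G"
  by (auto simp: letter_def a_closed b_closed split: sum.splits)

lemma letter_in_factors: "letter i s \<Longrightarrow> i \<in> factors"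
  by (auto simp: letter_def split: sum.splits)

lemma mem_gens_iff: "s \<in> S \<longleftrightarrow> (\<exists>i. letter i s)"
proof
  assume "s \<in> S"
  then consider n where "n < k" "s = a n \<or> s = inv a n" | n where "n < r" "s = b n"
    unfolding gens gen_set_def by blast
  then show "\<exists>i. letter i s"
  proof cases
    case (1 n) then show ?thesis by (intro exI[of _ "Inl n"]) (simp add: letter_def)
  next
    case (2 n) then show ?thesis by (intro exI[of _ "Inr n"]) (simp add: letter_def)
  qed
next
  assume "\<exists>i. letter i s"
  then obtain i where "letter i s" ..
  then show "s \<in> S"
    unfolding gens gen_set_def by (cases i) (auto simp: letter_def)
qed

lemma gens_closed: "s \<in> S \<Longrightarrow> s \<in> carrier G"
  by (auto simp: mem_gens_iff letter_closed)

lemma finite_gens: "finite S"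
  by (simp add: gens gen_set_def)

lemma letter_inv: "letter i s \<Longrightarrow> letter i (inv s)"
proof (cases i)
  case (Inr n)
  assume "letter i s"
  with Inr have "n < r" "s = b n" by (auto simp: letter_def)
  with Inr inv_equality[OF carrier_generated_b(2)] show ?thesis
    by (simp add: letter_def b_closed)
qed (auto simp: letter_def a_closed)

lemma inv_mem_gens: "s \<in> S \<Longrightarrow> inv s \<in> S"
  using letter_inv by (fastforce simp: mem_gens_iff)

lemma letter_eq_or_inv: "letter i s \<Longrightarrow> letter i t \<Longrightarrow> s = t \<or> s = inv t"
  by (auto simp: letter_def a_closed split: sum.splits)

lemma subgroup_factor: "i \<in> factors \<Longrightarrow> subgroup (factor i) G"
  using free unfolding free_product_Z_Z2_def is_free_product_def factor_def by blast

lemma letter_pow_in_factor: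
  assumes "letter i s"
  shows "s [^] (m::nat) \<in> factor i"
proof -
  interpret H: subgroup "factor i" G
    by (rule subgroup_factor[OF letter_in_factors[OF assms]])
  have "s \<in> factor i"
  proof (cases i)
    case (Inl n)
    with assms have "n < k" "s = a n [^] (1::int) \<or> s = a n [^] (-1::int)"
      using a_closed by (auto simp: letter_def int_pow_neg)
    then show ?thesis
      by (auto simp only: Inl factor_def sum.case carrier_subgroup_generated_by_singleton[OF a_closed])
  next
    case (Inr n)
    with assms show ?thesis
      by (simp add: letter_def factor_def carrier_generated_b)
  qed
  then show ?thesis
    by (induction m) (simp_all)
qed

lemma letter_pow_ne_one:
  assumes "letter (Inl n) s" "m > 0"
  shows "s [^] (m::nat) \<noteq> \<one>"
proof
  assume eq: "s [^] m = \<one>"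
  from assms(1) have n: "n < k" and s: "s = a n \<or> s = inv a n"
    by (auto simp: letter_def)
  from eq s have "a n [^] m = \<one>"
    using a_closed[OF n] by (auto simp: nat_pow_inv)
  then have "a n [^] int m = \<one>"
    by (simp add: int_pow_int)
  then show False
    using a_int_pow_eq_one[OF n] assms(2) by fastforce
qed

lemma letter_ne_one:
  assumes "letter i s"
  shows "s \<noteq> \<one>"
proof (cases i)
  case (Inl n)
  with assms letter_pow_ne_one[of n s 1] letter_closed[OF assms] show ?thesis by simp
next
  case (Inr n)
  with assms carrier_generated_b(1)[of n] show ?thesis by (simp add: letter_def)
qed

lemma reduced_syllables_unique:
  assumes "v \<in> syllable_words" "v' \<in> syllable_words"
    and "word_value G v = word_value G v'" "word_value G v \<in> carrier G"
  shows "v = v'"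
proof -
  have "\<forall>x\<in>carrier G. \<exists>!v. v \<in> syllable_words \<and> word_value G v = x"
    using free
    unfolding free_product_Z_Z2_def is_free_product_def syllable_words_def factor_def by blast
  from bspec[OF this assms(4)] obtain u where
    u: "\<forall>u'. u' \<in> syllable_words \<and> word_value G u' = word_value G v \<longrightarrow> u' = u"
    by (rule ex1E)
  from u[rule_format, of v] u[rule_format, of v'] assms(1,2,3) show ?thesis by simp
qed

lemma factor_closed: "i \<in> factors \<Longrightarrow> g \<in> factor i \<Longrightarrow> g \<in> carrier G"
  using subgroup.mem_carrier[OF subgroup_factor] by blast

lemma syllable_words_Nil: "[] \<in> syllable_words"
  by (simp add: syllable_words_def reduced_words_def)

lemma syllable_words_Cons:
  "(i, g) # v \<in> syllable_words \<longleftrightarrow>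
     i \<in> factors \<and> g \<in> factor i \<and> g \<noteq> \<one> \<and> (v = [] \<or> i \<noteq> fst (hd v)) \<and> v \<in> syllable_words"
  by (cases v) (auto simp: syllable_words_def reduced_words_def)

lemma word_value_Nil: "word_value G [] = \<one>"
  by (simp add: word_value_def)

lemma word_value_Cons: "word_value G ((i, g) # v) = g \<otimes> word_value G v"
  by (simp add: word_value_def)

lemma word_value_closed: "v \<in> syllable_words \<Longrightarrow> word_value G v \<in> carrier G"
proof (induction v)
  case (Cons x v)
  then show ?case
    using factor_closed[of "fst x" "snd x"]
    by (cases x) (simp add: syllable_words_Cons word_value_Cons)
qed (simp add: word_value_def)

text \<open>A generator lying in two factors would be the value of two different one-syllable words.\<close>

lemma letter_index_unique:
  assumes "letter i s" "letter j s"
  shows "i = j"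
proof -
  have "[(i, s)] = [(j, s)]"
    using assms letter_pow_in_factor[OF assms(1), of 1] letter_pow_in_factor[OF assms(2), of 1]
    by (intro reduced_syllables_unique)
       (auto simp: syllable_words_Cons syllable_words_Nil word_value_Cons word_value_Nil letter_in_factors letter_ne_one letter_closed)
  then show ?thesis by simp
qed

text \<open>The steps of the walk are single generators, so group elements are rewritten over the alphabet
  \<open>S\<close>. A word in these letters is reduced if it contains no cancelling pair of neighbours.\<close>

definition reduced :: "'a list \<Rightarrow> bool" where
  "reduced w \<longleftrightarrow> set w \<subseteq> S \<and> successively (\<lambda>s t. s \<noteq> inv t) w"

definition product :: "'a list \<Rightarrow> 'a" where
  "product w = foldr (\<otimes>) w \<one>"

lemma product_simps [simp]: "product [] = \<one>" "product (s # w) = s \<otimes> product w"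
  by (simp_all add: product_def)

lemma product_closed: "set w \<subseteq> S \<Longrightarrow> product w \<in> carrier G"
  by (induction w) (auto simp: gens_closed)

lemma reduced_simps [simp]:
  "reduced []" "reduced (s # w) \<longleftrightarrow> s \<in> S \<and> reduced w \<and> (w = [] \<or> s \<noteq> inv hd w)"
  by (auto simp: reduced_def successively_Cons)

lemma reduced_closed: "reduced w \<Longrightarrow> product w \<in> carrier G"
  by (simp add: reduced_def product_closed)

text \<open>Collecting the maximal blocks of letters from one factor turns a reduced letter word into a
  reduced syllable word. Within a block all letters agree, because the only other letter of the same
  factor is the inverse; hence a block is a positive power of its letter, and it is nontrivial since
  \<open>a n\<close> has infinite order while a block of the involution \<open>b n\<close> has length one. The first
  letter of the word is recorded, as it is all that uniqueness needs.\<close>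

lemma reduced_imp_syllables:
  assumes "reduced (s # w)"
  shows "\<exists>i m v. letter i s \<and> m > 0 \<and>
           (i, s [^] (m::nat)) # v \<in> syllable_words \<and>
           word_value G ((i, s [^] m) # v) = product (s # w)"
  using assms
proof (induction w arbitrary: s)
  case Nil
  then obtain i where i: "letter i s" by (auto simp: mem_gens_iff)
  then have "[(i, s [^] (1::nat))] \<in> syllable_words"
    using letter_pow_in_factor[OF i, of 1]
    by (auto simp: syllable_words_Cons syllable_words_Nil letter_in_factors letter_ne_one letter_closed)
  then show ?case
    using i letter_closed[OF i] by (intro exI[of _ i] exI[of _ 1] exI[of _ "[]"])
      (auto simp: word_value_Cons word_value_Nil)
next
  case (Cons t w)
  then have s: "s \<in> S" and t: "reduced (t # w)" and st: "s \<noteq> inv t" by auto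
  from Cons.IH[OF t] obtain i m v where i: "letter i t" "m > 0"
    and v: "(i, t [^] (m::nat)) # v \<in> syllable_words"
    and val: "word_value G ((i, t [^] m) # v) = product (t # w)"
    by blast
  from s obtain j where j: "letter j s" by (auto simp: mem_gens_iff)
  note closed = letter_closed[OF i(1)] letter_closed[OF j]
  show ?case
  proof (cases "i = j")
    case True
    have s_eq: "s = t" using letter_eq_or_inv[OF j] i True st by auto
    obtain n where n: "j = Inl n"
      using st s_eq j carrier_generated_b(2) b_closed inv_equality
      by (cases j) (fastforce simp: letter_def)+
    have pow: "s [^] Suc m = s \<otimes> t [^] m"
      unfolding s_eq by (rule nat_pow_Suc2[OF closed(1)])
    have "word_value G v \<in> carrier G"
      using v by (simp only: syllable_words_Cons word_value_closed)
    then have "word_value G ((j, s [^] Suc m) # v) = product (s # t # w)"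
      using val closed unfolding pow by (simp add: word_value_Cons m_assoc)
    moreover have "(j, s [^] Suc m) # v \<in> syllable_words"
      using v True letter_pow_in_factor[OF j, of "Suc m"]
        letter_pow_ne_one[OF j[unfolded n], of "Suc m"] letter_in_factors[OF j]
      by (simp add: syllable_words_Cons del: nat_pow_Suc)
    ultimately show ?thesis using j by blast
  next
    case False
    have "(j, s [^] (1::nat)) # (i, t [^] m) # v \<in> syllable_words"
      using v False j letter_pow_in_factor[OF j, of 1] closed
      by (simp add: syllable_words_Cons letter_in_factors letter_ne_one)
    moreover have "word_value G ((j, s [^] (1::nat)) # (i, t [^] m) # v) = product (s # t # w)"
      using val closed by (simp add: word_value_Cons)
    ultimately show ?thesis using j by (metis zero_less_one)
  qed
qed

lemma reduced_syllablesE: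
  assumes "reduced (s # w)"
  obtains i m v where "letter i s" "m > 0"
    "(i, s [^] (m::nat)) # v \<in> syllable_words"
    "word_value G ((i, s [^] m) # v) = product (s # w)"
  using reduced_imp_syllables[OF assms] by (elim exE conjE) (rule that)

text \<open>Two reduced words with the same value have the same first syllable, a positive power of the
  respective first letter. Different first letters would be inverse to each other and the equation
  between their powers would be a torsion relation; so the first letters agree and can be cancelled.\<close>

lemma reduced_unique:
  assumes "reduced w" "reduced w'" "product w = product w'"
  shows "w = w'"
proof -
  have ne: False if red: "reduced (s # w)" and one: "product (s # w) = \<one>" for s w
  proof -
    obtain i m v where v: "(i, s [^] (m::nat)) # v \<in> syllable_words"
      "word_value G ((i, s [^] m) # v) = product (s # w)"
      by (rule reduced_syllablesE[OF red])
    have "(i, s [^] m) # v = []"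
      using one v by (intro reduced_syllables_unique) (simp_all add: syllable_words_Nil word_value_Nil)
    then show False by simp
  qed
  show ?thesis
    using assms
  proof (induction w arbitrary: w')
    case Nil
    then show ?case using ne by (cases w') auto
  next
    case (Cons s w)
    show ?case
    proof (cases w')
      case Nil
      then show ?thesis using Cons.prems ne by auto
    next
      case (Cons t u)
      note red = Cons.prems(1,2)[unfolded Cons]
      obtain i m v where i: "letter i s" "m > 0"
        "(i, s [^] (m::nat)) # v \<in> syllable_words"
        "word_value G ((i, s [^] m) # v) = product (s # w)"
        by (rule reduced_syllablesE[OF red(1)])
      obtain j n v' where j: "letter j t" "n > 0"
        "(j, t [^] (n::nat)) # v' \<in> syllable_words"
        "word_value G ((j, t [^] n) # v') = product (t # u)"
        by (rule reduced_syllablesE[OF red(2)])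
      have "(i, s [^] m) # v = (j, t [^] n) # v'"
        using i j Cons.prems(3) reduced_closed[OF red(1)]
        unfolding Cons by (intro reduced_syllables_unique) (simp_all only:)
      then have ij: "i = j" and pow: "s [^] m = t [^] n" by auto
      have "s = t"
      proof (rule ccontr)
        assume st: "s \<noteq> t"
        then have s: "s = inv t" using letter_eq_or_inv i j ij by blast
        with st obtain l where l: "j = Inl l"
          using j ij i by (cases j) (auto simp: letter_def)
        have "t [^] (m + n) = t [^] m \<otimes> s [^] m"
          using letter_closed[OF j(1)] by (simp add: pow nat_pow_mult)
        also have "\<dots> = \<one>"
          using letter_closed[OF j(1)] by (simp add: s nat_pow_inv)
        finally show False
          using letter_pow_ne_one[of l t "m + n"] j l by simp
      qed
      then have "product w = product u"
        using Cons.prems(3) red reduced_closed[of w] reduced_closed[of u]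
        unfolding Cons by (auto simp: gens_closed)
      then show ?thesis
        using Cons.IH[of u] red \<open>s = t\<close> Cons by auto
    qed
  qed
qed

lemma product_gens_mult:
  assumes "s \<in> S" "reduced w"
  shows "\<exists>w'. reduced w' \<and> product w' = s \<otimes> product w"
proof (cases "w \<noteq> [] \<and> s = inv hd w")
  case True
  then obtain t w' where w: "w = t # w'" by (cases w) auto
  then have "s \<otimes> product w = product w'"
    using True assms reduced_closed[of w'] m_assoc[of "inv t" t "product w'"]
    by (simp add: gens_closed)
  with assms w show ?thesis by auto
next
  case False
  with assms show ?thesis by (intro exI[of _ "s # w"]) auto
qed

text \<open>The values of reduced words are closed under left multiplication by a generator, hence by any
  power of one, hence by any syllable.\<close>

lemma reduced_exists:
  assumes "x \<in> carrier G"
  shows "\<exists>w. reduced w \<and> product w = x"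
proof -
  define R where "R = {x. \<exists>w. reduced w \<and> product w = x}"
  have R_closed: "x \<in> carrier G" if "x \<in> R" for x
    using that reduced_closed by (auto simp: R_def)
  have gen: "s \<otimes> x \<in> R" if "s \<in> S" "x \<in> R" for s x
    using that product_gens_mult by (fastforce simp: R_def)
  have pow: "s [^] (m::nat) \<otimes> x \<in> R" if "s \<in> S" "x \<in> R" for s m x
  proof (induction m)
    case (Suc m)
    have "s [^] Suc m \<otimes> x = s \<otimes> (s [^] m \<otimes> x)"
      using that nat_pow_Suc2[of s m]
      by (simp add: m_assoc gens_closed R_closed del: nat_pow_Suc)
    with gen[OF that(1) Suc.IH] show ?case by simp
  qed (simp add: that R_closed)
  have factor: "g \<otimes> x \<in> R" if i: "i \<in> factors" and g: "g \<in> factor i" and "x \<in> R" for i g x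
  proof -
    obtain s where s: "s \<in> S" "g \<in> range (\<lambda>m::int. s [^] m)"
    proof (cases i)
      case (Inl n)
      then have "a n \<in> S" using i by (auto simp: mem_gens_iff letter_def intro!: exI[of _ i])
      with that[of "a n"] Inl i g show ?thesis
        by (auto simp: factor_def carrier_subgroup_generated_by_singleton a_closed)
    next
      case (Inr n)
      then have "b n \<in> S" using i by (auto simp: mem_gens_iff letter_def intro!: exI[of _ i])
      with that[of "b n"] Inr i g show ?thesis
        by (auto simp: factor_def carrier_subgroup_generated_by_singleton b_closed)
    qed
    then obtain m :: int where m: "g = s [^] m" by auto
    have "g = s [^] nat m \<or> g = (inv s) [^] nat (- m)"
      unfolding m int_pow_def2 by (cases "m < 0") (simp_all only: nat_pow_inv[OF gens_closed[OF s(1)]] if_True if_False simp_thms)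
    then show ?thesis
      using pow[OF s(1) \<open>x \<in> R\<close>] pow[OF inv_mem_gens[OF s(1)] \<open>x \<in> R\<close>] by auto
  qed
  obtain v where v: "v \<in> syllable_words" "word_value G v = x"
    using assms free
    unfolding free_product_Z_Z2_def is_free_product_def syllable_words_def factor_def by blast
  have "\<one> \<in> R" by (auto simp: R_def intro!: exI[of _ "[]"])
  have "word_value G v \<in> R" if "v \<in> syllable_words" for v
    using that
  proof (induction v)
    case (Cons x v)
    then show ?case
      by (cases x) (auto simp: syllable_words_Cons word_value_Cons intro: factor)
  qed (simp add: word_value_Nil \<open>\<one> \<in> R\<close>)
  with v show ?thesis
    by (auto simp: R_def)
qed

text \<open>The ellipticity bound is summed over the generators, so it matters that none of the \<open>2 * k + r\<close>
  named generators coincide.\<close>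

lemma card_gens: "card S = 2 * k + r"
proof -
  have a_index: "m = n" if "m < k" "n < k" "s = a m \<or> s = inv a m" "s = a n \<or> s = inv a n" for m n s
    using letter_index_unique[of "Inl m" s "Inl n"] that by (simp add: letter_def)
  have ab: False if "m < k" "n < r" "b n = a m \<or> b n = inv a m" for m n
    using letter_index_unique[of "Inl m" "b n" "Inr n"] that by (simp add: letter_def)
  have b_index: "m = n" if "m < r" "n < r" "b m = b n" for m n
    using letter_index_unique[of "Inr m" "b m" "Inr n"] that by (simp add: letter_def)
  have a_inv: False if "n < k" "a n = inv a n" for n
  proof -
    have "a n [^] (2::nat) = \<one>"
      using that(2) r_inv[OF a_closed[OF that(1)]] a_closed[OF that(1)]
      by (simp add: numeral_2_eq_2)
    then show False
      using letter_pow_ne_one[of n "a n" 2] that(1) by (simp add: letter_def)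
  qed
  have mixed: False if "m < k" "n < k" "a m = inv a n" for m n
    using a_index[of m n "a m"] a_inv[of m] that by simp
  have "card (a ` {..<k}) = k" "card ((\<lambda>n. inv a n) ` {..<k}) = k" "card (b ` {..<r}) = r"
    using a_index[of _ _ "a _", OF _ _ disjI1 disjI1] a_index[of _ _ "inv a _", OF _ _ disjI2 disjI2] b_index
    by (simp_all add: card_image inj_on_def)
  moreover have "a ` {..<k} \<inter> (\<lambda>n. inv a n) ` {..<k} = {}"
    using mixed by auto
  moreover have "(a ` {..<k} \<union> (\<lambda>n. inv a n) ` {..<k}) \<inter> b ` {..<r} = {}"
  proof (intro equalityI subsetI)
    fix s assume "s \<in> (a ` {..<k} \<union> (\<lambda>n. inv a n) ` {..<k}) \<inter> b ` {..<r}"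
    then obtain m n where "m < k" "n < r" "b n = a m \<or> b n = inv a m" by auto
    then show "s \<in> {}" using ab by blast
  qed simp
  ultimately show ?thesis
    unfolding gens gen_set_def by (subst card_Un_disjoint; simp add: card_Un_disjoint)
qed

section \<open>Levels in the Cayley tree\<close>

text \<open>The vertices visited when the letters of a word are multiplied up from the right, starting at
  the root.\<close>

primrec path :: "'a list \<Rightarrow> 'a list" where
  "path [] = [\<one>]"
| "path (s # w) = path w @ [product (s # w)]"

lemma path_not_Nil: "path w \<noteq> []"
  by (cases w) simp_all

lemma hd_path: "hd (path w) = \<one>"
  by (induction w) (simp_all add: hd_append path_not_Nil)

lemma last_path: "last (path w) = product w"
  by (cases w) simp_all

lemma length_path: "length (path w) = Suc (length w)"
  by (induction w) simp_all

lemma mem_path: "reduced w \<Longrightarrow> x \<in> set (path w) \<Longrightarrow> \<exists>u. reduced u \<and> length u \<le> length w \<and> x = product u"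
proof (induction w)
  case (Cons s w)
  show ?case
  proof (cases "x \<in> set (path w)")
    case True
    with Cons.prems Cons.IH obtain u where "reduced u" "length u \<le> length w" "x = product u"
      by auto
    then show ?thesis by (intro exI[of _ u]) simp
  next
    case False
    with Cons.prems(2) have "x = product (s # w)" by simp
    with Cons.prems(1) show ?thesis by blast
  qed
next
  case Nil
  then have "x = product []" by simp
  then show ?case by (intro exI[of _ "[]"]) simp
qed

text \<open>The vertices on the path of a reduced word are the values of its suffixes. These are reduced
  words of different lengths, so no vertex is repeated.\<close>

lemma cayley_path_path:
  assumes "reduced w"
  shows "cayley_path G S \<one> (path w) (product w)"
  using assms
proof (induction w)
  case (Cons s w)
  then have s: "s \<in> S" and w: "reduced w" by auto
  note IH = Cons.IH[OF w, unfolded cayley_path_def]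
  have "product (s # w) \<notin> set (path w)"
  proof
    assume "product (s # w) \<in> set (path w)"
    from mem_path[OF w this] obtain u where u: "reduced u" "length u \<le> length w" "product (s # w) = product u"
      by blast
    from reduced_unique[OF Cons.prems u(1) u(3)] u(2) show False by auto
  qed
  moreover have "product (s # w) \<in> neighbors G S (product w)"
    using s reduced_closed[OF w] by (simp add: neighbors_def gens_closed m_assoc)
  ultimately show ?case
    using IH by (simp add: cayley_path_def successively_append_iff path_not_Nil hd_path last_path
        neighbors_def)
qed (simp add: cayley_path_def)

text \<open>Conversely, a step of a self-avoiding path that cancelled the preceding letter would return to
  the vertex before it, so the letters of the steps form a reduced word.\<close>

lemma cayley_path_imp_path:
  assumes "cayley_path G S \<one> p x"
  shows "\<exists>w. reduced w \<and> p = path w \<and> x = product w"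
  using assms
proof (induction p arbitrary: x rule: rev_induct)
  case (snoc y p)
  from snoc.prems have y: "y = x" by (simp add: cayley_path_def)
  show ?case
  proof (cases "p = []")
    case True
    with snoc.prems y have "x = \<one>" by (simp add: cayley_path_def)
    with True y show ?thesis
      by (intro exI[of _ "[]"]) simp
  next
    case False
    with snoc.prems have p: "cayley_path G S \<one> p (last p)" and x: "x \<in> neighbors G S (last p)"
      and new: "x \<notin> set p"
      by (auto simp: cayley_path_def successively_append_iff y)
    from snoc.IH[OF p] obtain w where w: "reduced w" "p = path w" "last p = product w"
      by blast
    note closed = reduced_closed[OF w(1)]
    define s where "s = x \<otimes> inv product w"
    have s: "s \<in> S" "x = s \<otimes> product w"
      using x closed by (auto simp: s_def neighbors_def w(3) m_assoc)
    have "s \<noteq> inv hd w" if nonempty: "w \<noteq> []"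
    proof
      assume eq: "s = inv hd w"
      obtain t u where u: "w = t # u" using nonempty by (cases w) auto
      have "x = product u"
        using w(1) eq reduced_closed[of u] m_assoc[of "inv t" t "product u"]
        by (simp add: s(2) u gens_closed)
      moreover have "product u \<in> set (path u)"
        using path_not_Nil[of u] last_path[of u] last_in_set by metis
      ultimately show False
        using new by (simp add: w(2) u)
    qed
    with s w(1) have "reduced (s # w)" by auto
    then show ?thesis
      using s w by (intro exI[of _ "s # w"]) (simp add: y)
  qed
qed (simp add: cayley_path_def)

lemma level_product:
  assumes "reduced w"
  shows "level G S (product w) = length w"
proof -
  have "(THE p. cayley_path G S \<one> p (product w)) = path w"
  proof (rule the_equality)
    show "p = path w" if "cayley_path G S \<one> p (product w)" for p
      using cayley_path_imp_path[OF that] reduced_unique[OF assms] by auto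
  qed (rule cayley_path_path[OF assms])
  then show ?thesis by (simp add: level_def length_path)
qed

lemma level_one: "level G S \<one> = 0"
  using level_product[of "[]"] by simp

text \<open>Multiplying a reduced word by \<open>s\<close> on the left makes it longer by one unless \<open>s\<close> is the inverse
  of its first letter. At the root every neighbour is on level one, and \<open>t\<close> is then an arbitrary
  generator.\<close>

lemma level_neighbors:
  assumes x: "x \<in> carrier G" and S: "S \<noteq> {}"
  obtains t where "t \<in> S" "level G S x \<le> Suc (level G S (t \<otimes> x))"
    "\<And>s. s \<in> S \<Longrightarrow> s \<noteq> t \<Longrightarrow> level G S (s \<otimes> x) = Suc (level G S x)"
proof -
  obtain w where w: "reduced w" "product w = x" using reduced_exists[OF x] by blast
  have up: "level G S (s \<otimes> x) = Suc (level G S x)"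
    if "s \<in> S" "w = [] \<or> s \<noteq> inv hd w" for s
    using level_product[OF w(1)] level_product[of "s # w"] w that by simp
  show ?thesis
  proof (cases w)
    case Nil
    from S obtain t where "t \<in> S" by blast
    with Nil up that[of t] show ?thesis by simp
  next
    case (Cons u v)
    have "inv u \<otimes> x = product v"
      using w(1) Cons reduced_closed[of v] m_assoc[of "inv u" u "product v"]
      by (simp add: gens_closed flip: w(2))
    moreover have "length w \<le> Suc (level G S (product v))"
      using w(1) Cons by (simp add: level_product)
    ultimately show ?thesis
      using that[of "inv u"] up w Cons level_product[OF w(1)] by (simp add: inv_mem_gens)
  qed
qed

end

section \<open>Geometric decay along a Markov chain\<close>

text \<open>Disintegration over the values of a random variable with countable range; it is applied to
  the past of the walk and to its next position.\<close>

lemma nn_integral_split_countable: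
  assumes "countable A" and Y: "Y \<in> M \<rightarrow>\<^sub>M count_space A" and h: "h \<in> borel_measurable M"
  shows "(\<integral>\<^sup>+x. h x \<partial>M) = (\<integral>\<^sup>+p. (\<integral>\<^sup>+x. h x * indicator {p} (Y x) \<partial>M) \<partial>count_space A)"
proof -
  note [measurable] = Y h
  have ind: "(\<lambda>x. indicator {p} (Y x) :: ennreal) \<in> borel_measurable M" if "p \<in> A" for p
    using that by (intro measurable_compose[OF Y]) simp
  have "(\<integral>\<^sup>+p. (\<integral>\<^sup>+x. h x * indicator {p} (Y x) \<partial>M) \<partial>count_space A) =
      (\<integral>\<^sup>+x. (\<integral>\<^sup>+p. h x * indicator {p} (Y x) \<partial>count_space A) \<partial>M)"
    using assms(1) h ind by (intro nn_integral_count_space_nn_integral[symmetric]) auto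
  also have "\<dots> = (\<integral>\<^sup>+x. h x \<partial>M)"
  proof (rule nn_integral_cong)
    fix x assume "x \<in> space M"
    then have Yx: "Y x \<in> A" using measurable_space[OF Y] by simp
    have "(\<integral>\<^sup>+p. h x * indicator {p} (Y x) \<partial>count_space A) =
        h x * (\<integral>\<^sup>+p. indicator {Y x} p \<partial>count_space A)"
      by (subst nn_integral_cmult[symmetric]) (auto intro!: nn_integral_cong simp: indicator_def)
    also have "\<dots> = h x"
      using Yx by simp
    finally show "(\<integral>\<^sup>+p. h x * indicator {p} (Y x) \<partial>count_space A) = h x" .
  qed
  finally show ?thesis by simp
qed

lemma nn_integral_count_space_le_pmf:
  "(\<integral>\<^sup>+y. f y * ennreal (pmf p y) \<partial>count_space A) \<le> (\<integral>\<^sup>+y. f y \<partial>measure_pmf p)"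
proof -
  have "(\<integral>\<^sup>+y. f y * ennreal (pmf p y) \<partial>count_space A) =
      (\<integral>\<^sup>+y. f y * ennreal (pmf p y) * indicator A y \<partial>count_space UNIV)"
    by (rule nn_integral_count_space_indicator) simp
  also have "\<dots> \<le> (\<integral>\<^sup>+y. ennreal (pmf p y) * f y \<partial>count_space UNIV)"
    by (intro nn_integral_mono) (auto simp: indicator_def mult.commute)
  also have "\<dots> = (\<integral>\<^sup>+y. f y \<partial>measure_pmf p)"
    by (rule nn_integral_measure_pmf[symmetric])
  finally show ?thesis .
qed

text \<open>If one step of the chain shrinks the mean of \<open>f\<close> by a factor \<open>\<rho>\<close>, then \<open>n\<close> steps shrink it by
  \<open>\<rho> ^ n\<close>. The Markov property is used in its most elementary form: on each of the countably many
  histories \<open>(X\<^sub>0, \<dots>, X\<^sub>n)\<close>, the probabilities of cylinders factor into transition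
  probabilities.\<close>

lemma quenched_contraction:
  fixes f :: "'g \<Rightarrow> ennreal"
  assumes c: "countable (carrier G)"
    and supp: "\<And>y. y \<in> carrier G \<Longrightarrow> set_pmf (\<omega> y) \<subseteq> carrier G" and x: "x \<in> carrier G"
    and step: "\<And>y. y \<in> carrier G \<Longrightarrow> (\<integral>\<^sup>+z. f z \<partial>measure_pmf (\<omega> y)) \<le> \<rho> * f y"
  shows "(\<integral>\<^sup>+X. f (X n) \<partial>quenched_law G \<omega> x) \<le> \<rho> ^ n * f x"
proof -
  define Q where "Q = quenched_law G \<omega> x"
  \<comment> \<open>\<open>C n\<close> is the set of possible histories up to time \<open>n\<close>, and \<open>W n p\<close> the probability of the
    history \<open>p\<close>.\<close>
  define C where "C n = ({..n} \<rightarrow>\<^sub>E carrier G)" for n :: nat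
  define W where "W n p = ennreal (indicator {x} (p 0) * (\<Prod>i<n. pmf (\<omega> (p i)) (p (Suc i))))"
    for n and p :: "nat \<Rightarrow> 'g"
  define past where "past n X = restrict X {..n}" for n and X :: "nat \<Rightarrow> 'g"
  have setsQ: "sets Q = sets (traj_space G)"
    unfolding Q_def by (rule sets_quenched_law[OF supp x])
  have spQ: "space Q = UNIV \<rightarrow> carrier G"
    using sets_eq_imp_space_eq[OF setsQ] by (auto simp: traj_space_def space_PiM)
  have cC: "countable (C n)" for n
    unfolding C_def by (rule countable_PiE) (auto intro: c)
  have cyl: "{X \<in> space Q. \<forall>i\<le>n. X i = p i} \<in> sets Q"
      "emeasure Q {X \<in> space Q. \<forall>i\<le>n. X i = p i} = W n p" if "p \<in> {..n} \<rightarrow> carrier G" for n p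
  proof -
    note sp = sets_eq_imp_space_eq[OF setsQ]
    show "{X \<in> space Q. \<forall>i\<le>n. X i = p i} \<in> sets Q"
      unfolding setsQ sets_traj_space_cylinders[OF c] sp
      by (rule sigma_sets.Basic) (use that in blast)
    show "emeasure Q {X \<in> space Q. \<forall>i\<le>n. X i = p i} = W n p"
      unfolding sp unfolding Q_def W_def by (rule emeasure_quenched_law_cylinder[OF supp x that])
  qed
  have C_Pi: "p \<in> {..n} \<rightarrow> carrier G" if "p \<in> C n" for n p
    using that by (auto simp: C_def PiE_iff)
  have past_iff: "past n X = p \<longleftrightarrow> (\<forall>i\<le>n. X i = p i)" if "p \<in> C n" for n p X
    using that by (auto simp: past_def C_def PiE_iff extensional_def fun_eq_iff)
  have past: "past n \<in> Q \<rightarrow>\<^sub>M count_space (C n)" for n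
    unfolding measurable_count_space_eq_countable[OF cC]
  proof (intro conjI ballI)
    show "past n \<in> space Q \<rightarrow> C n"
      by (auto simp: past_def C_def spQ split: if_splits)
    fix p assume p: "p \<in> C n"
    have "past n -` {p} \<inter> space Q = {X \<in> space Q. \<forall>i\<le>n. X i = p i}"
      using past_iff[OF p] by auto
    also have "\<dots> \<in> sets Q"
      by (rule cyl(1)[OF C_Pi[OF p]])
    finally show "past n -` {p} \<inter> space Q \<in> sets Q" .
  qed
  have coord: "(\<lambda>X. X n) \<in> Q \<rightarrow>\<^sub>M count_space (carrier G)" for n
    unfolding measurable_cong_sets[OF setsQ refl] traj_space_def by measurable
  have fX: "(\<lambda>X. f (X n)) \<in> borel_measurable Q" for n
    by (rule measurable_compose[OF coord]) simp
  have W: "(\<integral>\<^sup>+X. f (X n) * indicator {p} (past n X) \<partial>Q) = f (p n) * W n p" if p: "p \<in> C n" for n p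
  proof -
    have "(\<integral>\<^sup>+X. f (X n) * indicator {p} (past n X) \<partial>Q) =
        (\<integral>\<^sup>+X. f (p n) * indicator {X \<in> space Q. \<forall>i\<le>n. X i = p i} X \<partial>Q)"
      by (intro nn_integral_cong) (simp add: indicator_def past_iff[OF p])
    also have "\<dots> = f (p n) * W n p"
      by (simp only: nn_integral_cmult_indicator[OF cyl(1)[OF C_Pi[OF p]]] cyl(2)[OF C_Pi[OF p]])
    finally show ?thesis .
  qed
  have W_Suc: "(\<integral>\<^sup>+X. f (X (Suc n)) * indicator {p} (past n X) * indicator {y} (X (Suc n)) \<partial>Q) =
      W n p * (f y * ennreal (pmf (\<omega> (p n)) y))" if p: "p \<in> C n" and y: "y \<in> carrier G" for n p y
  proof -
    let ?q = "p(Suc n := y)"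
    have q: "?q \<in> {..Suc n} \<rightarrow> carrier G"
      using p y by (auto simp: C_def PiE_iff)
    have upto_Suc: "(\<forall>i\<le>Suc n. X i = ?q i) \<longleftrightarrow> (\<forall>i\<le>n. X i = p i) \<and> X (Suc n) = y" for X
      by (auto simp: le_Suc_eq)
    have "(\<integral>\<^sup>+X. f (X (Suc n)) * indicator {p} (past n X) * indicator {y} (X (Suc n)) \<partial>Q) =
        (\<integral>\<^sup>+X. f y * indicator {X \<in> space Q. \<forall>i\<le>Suc n. X i = ?q i} X \<partial>Q)"
      unfolding upto_Suc by (intro nn_integral_cong) (simp add: indicator_def past_iff[OF p])
    also have "\<dots> = f y * W (Suc n) ?q"
      by (simp only: nn_integral_cmult_indicator[OF cyl(1)[OF q]] cyl(2)[OF q])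
    also have "W (Suc n) ?q = W n p * ennreal (pmf (\<omega> (p n)) y)"
      by (simp add: W_def ennreal_mult' [symmetric] prod_nonneg mult_ac)
    finally show ?thesis by (simp add: mult_ac)
  qed
  have "(\<integral>\<^sup>+X. f (X n) \<partial>Q) \<le> \<rho> ^ n * f x"
  proof (induction n)
    case 0
    interpret Q: prob_space Q
      unfolding Q_def by (rule prob_space_quenched_law[OF supp x])
    have start: "{X \<in> space Q. X 0 = x} \<in> sets Q" "emeasure Q {X \<in> space Q. X 0 = x} = 1"
      using cyl[of "\<lambda>_. x" 0] x by (simp_all add: W_def)
    have "AE X in Q. X 0 = x"
      using Q.AE_in_set_eq_1[OF start(1)] start(2) by (simp add: Q.emeasure_eq_measure)
    then have "(\<integral>\<^sup>+X. f (X 0) \<partial>Q) = (\<integral>\<^sup>+X. f x \<partial>Q)"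
      by (intro nn_integral_cong_AE) auto
    then show ?case by (simp add: Q.emeasure_space_1)
  next
    case (Suc n)
    have "(\<integral>\<^sup>+X. f (X (Suc n)) \<partial>Q) =
        (\<integral>\<^sup>+p. (\<integral>\<^sup>+X. f (X (Suc n)) * indicator {p} (past n X) \<partial>Q) \<partial>count_space (C n))"
      by (rule nn_integral_split_countable[OF cC past fX])
    also have "\<dots> = (\<integral>\<^sup>+p. (\<integral>\<^sup>+y. W n p * (f y * ennreal (pmf (\<omega> (p n)) y))
        \<partial>count_space (carrier G)) \<partial>count_space (C n))"
    proof (rule nn_integral_cong)
      fix p assume "p \<in> space (count_space (C n))"
      then have p: "p \<in> C n" by simp
      have "(\<lambda>X. indicator {p} (past n X) :: ennreal) \<in> borel_measurable Q"
        by (rule measurable_compose[OF past]) simp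
      with fX have m: "(\<lambda>X. f (X (Suc n)) * indicator {p} (past n X)) \<in> borel_measurable Q"
        by (rule borel_measurable_times_ennreal)
      show "(\<integral>\<^sup>+X. f (X (Suc n)) * indicator {p} (past n X) \<partial>Q) =
          (\<integral>\<^sup>+y. W n p * (f y * ennreal (pmf (\<omega> (p n)) y)) \<partial>count_space (carrier G))"
        unfolding nn_integral_split_countable[OF c coord[of "Suc n"] m]
        by (intro nn_integral_cong W_Suc p) simp
    qed
    also have "\<dots> \<le> (\<integral>\<^sup>+p. \<rho> * (f (p n) * W n p) \<partial>count_space (C n))"
    proof (rule nn_integral_mono)
      fix p assume "p \<in> space (count_space (C n))"
      then have pn: "p n \<in> carrier G" by (auto simp: C_def)
      have "(\<integral>\<^sup>+y. W n p * (f y * ennreal (pmf (\<omega> (p n)) y)) \<partial>count_space (carrier G)) =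
          W n p * (\<integral>\<^sup>+y. f y * ennreal (pmf (\<omega> (p n)) y) \<partial>count_space (carrier G))"
        by (rule nn_integral_cmult) simp
      also have "\<dots> \<le> W n p * (\<rho> * f (p n))"
        using order_trans[OF nn_integral_count_space_le_pmf step[OF pn]] by (rule mult_left_mono) simp
      finally show "(\<integral>\<^sup>+y. W n p * (f y * ennreal (pmf (\<omega> (p n)) y)) \<partial>count_space (carrier G)) \<le>
          \<rho> * (f (p n) * W n p)" by (simp add: mult_ac)
    qed
    also have "\<dots> = \<rho> * (\<integral>\<^sup>+p. f (p n) * W n p \<partial>count_space (C n))"
      by (rule nn_integral_cmult) simp
    also have "(\<integral>\<^sup>+p. f (p n) * W n p \<partial>count_space (C n)) = (\<integral>\<^sup>+X. f (X n) \<partial>Q)"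
      unfolding nn_integral_split_countable[OF cC past fX, of n n]
      by (intro nn_integral_cong W[symmetric]) simp
    also have "\<rho> * \<dots> \<le> \<rho> * (\<rho> ^ n * f x)"
      by (rule mult_left_mono[OF Suc.IH]) simp
    finally show ?case by (simp add: mult_ac)
  qed
  then show ?thesis by (simp only: Q_def)
qed

text \<open>By Markov's inequality, \<open>L n \<le> c * n\<close> has probability at most \<open>(\<rho> / z powr c) ^ n\<close>. This is
  summable as soon as \<open>z powr c > \<rho>\<close>, that is, for small \<open>c > 0\<close>, and then the Borel-Cantelli lemma
  applies.\<close>

lemma AE_linear_growth_of_geometric_moments:
  fixes L :: "nat \<Rightarrow> 'x \<Rightarrow> nat" and z \<rho> :: real
  assumes "prob_space M" and L: "\<And>n. L n \<in> M \<rightarrow>\<^sub>M count_space UNIV"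
    and z: "0 < z" "z < 1" and \<rho>: "0 < \<rho>" "\<rho> < 1"
    and moment: "\<And>n. (\<integral>\<^sup>+x. ennreal (z ^ L n x) \<partial>M) \<le> ennreal (\<rho> ^ n)"
  shows "AE x in M. liminf (\<lambda>n. ereal (real (L n x) / real n)) > 0"
proof -
  interpret prob_space M by fact
  \<comment> \<open>With this choice \<open>z powr c = sqrt \<rho>\<close>, halfway between \<open>\<rho>\<close> and \<open>1\<close> on the logarithmic scale.\<close>
  define c where "c = ln \<rho> / (2 * ln z)"
  have c: "c > 0"
    using z \<rho> by (simp add: c_def divide_neg_neg)
  define q where "q = sqrt \<rho>"
  have q: "0 < q" "q < 1" using \<rho> by (simp_all add: q_def)
  have z_powr: "z powr (c * real n) = q ^ n" for n
  proof -
    have "z powr c = q"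
      using z \<rho> by (simp add: powr_def c_def q_def ln_sqrt[symmetric])
    then show ?thesis
      using z q by (simp add: powr_powr[symmetric] powr_realpow)
  qed
  define A where "A n = {x \<in> space M. real (L n x) \<le> c * real n}" for n
  have A[measurable]: "A n \<in> sets M" for n
  proof -
    note [measurable] = L
    show ?thesis unfolding A_def by measurable
  qed
  have bound: "measure M (A n) \<le> q ^ n" for n
  proof -
    have "ennreal (q ^ n) * emeasure M (A n) = (\<integral>\<^sup>+x. ennreal (q ^ n) * indicator (A n) x \<partial>M)"
      by (simp add: nn_integral_cmult_indicator)
    also have "\<dots> \<le> (\<integral>\<^sup>+x. ennreal (z ^ L n x) \<partial>M)"
    proof (rule nn_integral_mono)
      fix x
      have "q ^ n \<le> z ^ L n x" if "x \<in> A n"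
      proof -
        have "z powr (c * real n) \<le> z powr real (L n x)"
          using that z by (intro powr_mono') (auto simp: A_def)
        then show ?thesis using z by (simp add: z_powr powr_realpow)
      qed
      then show "ennreal (q ^ n) * indicator (A n) x \<le> ennreal (z ^ L n x)"
        by (auto simp: indicator_def intro: ennreal_leI)
    qed
    also have "\<dots> \<le> ennreal (\<rho> ^ n)" by (rule moment)
    also have "\<rho> ^ n = q ^ n * q ^ n"
      using \<rho> by (simp add: q_def flip: power_mult_distrib)
    finally have "ennreal (q ^ n * measure M (A n)) \<le> ennreal (q ^ n * q ^ n)"
      using q by (simp add: emeasure_eq_measure ennreal_mult')
    then show ?thesis
      using q by (simp add: ennreal_le_iff)
  qed
  have "summable (\<lambda>n. measure M (A n))"
    by (rule summable_comparison_test'[of "\<lambda>n. q ^ n" 0]) (use bound q in auto)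
  then have "AE x in M. eventually (\<lambda>n. x \<in> space M - A n) sequentially"
    by (intro borel_cantelli_AE1) (auto simp: emeasure_eq_measure)
  then show ?thesis
  proof eventually_elim
    case (elim x)
    have "eventually (\<lambda>n. ereal c \<le> ereal (real (L n x) / real n)) sequentially"
      using elim eventually_gt_at_top[of 0]
      by eventually_elim (auto simp: A_def field_simps)
    then have "ereal c \<le> liminf (\<lambda>n. ereal (real (L n x) / real n))"
      by (rule Liminf_bounded)
    with c show ?case by (metis ereal_less(2) order_less_le_trans)
  qed
qed

section \<open>The walk in a uniformly elliptic environment\<close>

context Z_Z2_free_product begin

text \<open>The step towards the root multiplies \<open>z ^ level G S x\<close> by \<open>1 / z\<close>, every other step by \<open>z\<close>.
  The bad step has probability at most \<open>1 - (card S - 1) * \<epsilon>\<close>, because each of the other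
  \<open>card S - 1\<close> neighbours takes at least \<open>\<epsilon>\<close>. At the root, where all steps lead
  away, the bound only becomes weaker.\<close>

lemma drift_exp_moment:
  fixes p :: "'a pmf" and \<epsilon> z :: real
  assumes x: "x \<in> carrier G" and S: "S \<noteq> {}"
    and supp: "set_pmf p \<subseteq> (\<lambda>s. s \<otimes> x) ` S"
    and elliptic: "\<And>s. s \<in> S \<Longrightarrow> \<epsilon> \<le> pmf p (s \<otimes> x)"
    and z: "0 < z" "z < 1"
  shows "(\<integral>\<^sup>+y. ennreal (z ^ level G S y) \<partial>measure_pmf p) \<le>
           ennreal (z + (1 - (real (card S) - 1) * \<epsilon>) * (1 / z - z)) * ennreal (z ^ level G S x)"
proof -
  let ?l = "level G S"
  obtain t where t: "t \<in> S" "?l x \<le> Suc (?l (t \<otimes> x))"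
    and up: "\<And>s. s \<in> S \<Longrightarrow> s \<noteq> t \<Longrightarrow> ?l (s \<otimes> x) = Suc (?l x)"
    using level_neighbors[OF x S] by metis
  define L where "L = z ^ ?l x"
  have L: "L > 0" using z by (simp add: L_def)
  have gap: "0 \<le> 1 / z - z"
    using z by (simp add: field_simps mult_le_one)
  have down: "pmf p (t \<otimes> x) \<le> 1 - (real (card S) - 1) * \<epsilon>"
  proof -
    have inj: "inj_on (\<lambda>s. s \<otimes> x) S"
      using x gens_closed by (intro inj_onI) auto
    have "pmf p (t \<otimes> x) + (\<Sum>s\<in>S - {t}. pmf p (s \<otimes> x)) = (\<Sum>s\<in>S. pmf p (s \<otimes> x))"
      using t finite_gens by (simp add: sum.remove)
    also have "\<dots> = measure (measure_pmf p) ((\<lambda>s. s \<otimes> x) ` S)"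
      using inj finite_gens by (simp add: measure_measure_pmf_finite sum.reindex)
    also have "\<dots> \<le> 1" by simp
    finally have "pmf p (t \<otimes> x) + (\<Sum>s\<in>S - {t}. pmf p (s \<otimes> x)) \<le> 1" .
    moreover have "(\<Sum>s\<in>S - {t}. \<epsilon>) \<le> (\<Sum>s\<in>S - {t}. pmf p (s \<otimes> x))"
      using elliptic by (intro sum_mono) auto
    moreover have "real (card (S - {t})) = real (card S) - 1"
      using t finite_gens card_gt_0_iff[of S] by (auto simp: card_Diff_singleton of_nat_diff)
    ultimately show ?thesis by simp
  qed
  have "(\<integral>\<^sup>+y. ennreal (z ^ ?l y) \<partial>measure_pmf p) \<le>
      (\<integral>\<^sup>+y. ennreal (L * z) + ennreal (L * (1 / z - z)) * indicator {t \<otimes> x} y \<partial>measure_pmf p)"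
  proof (rule nn_integral_mono_AE, unfold AE_measure_pmf_iff, rule ballI)
    fix y assume "y \<in> set_pmf p"
    then obtain s where s: "s \<in> S" "y = s \<otimes> x" using supp by auto
    show "ennreal (z ^ ?l y) \<le> ennreal (L * z) + ennreal (L * (1 / z - z)) * indicator {t \<otimes> x} y"
    proof (cases "s = t")
      case True
      have "z * z ^ ?l y \<le> L"
        using power_decreasing[OF t(2), of z] z by (simp add: L_def s True)
      then have "z ^ ?l y \<le> L * z + L * (1 / z - z)"
        using z by (simp add: field_simps)
      then have "ennreal (z ^ ?l y) \<le> ennreal (L * z + L * (1 / z - z))"
        by (rule ennreal_leI)
      then show ?thesis
        using z L gap by (simp add: s True ennreal_plus)
    next
      case False
      then have "z ^ ?l y = L * z"
        using up[OF s(1)] by (simp add: s L_def)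
      then show ?thesis by simp
    qed
  qed
  also have "\<dots> = ennreal (L * z) + ennreal (L * (1 / z - z)) * ennreal (pmf p (t \<otimes> x))"
    by (subst nn_integral_add) (simp_all add: nn_integral_cmult_indicator emeasure_pmf_single)
  also have "\<dots> = ennreal (L * z + L * (1 / z - z) * pmf p (t \<otimes> x))"
    using z L gap by (simp add: ennreal_plus ennreal_mult')
  also have "\<dots> \<le> ennreal ((z + (1 - (real (card S) - 1) * \<epsilon>) * (1 / z - z)) * L)"
  proof (rule ennreal_leI)
    have "(L * (1 / z - z)) * pmf p (t \<otimes> x) \<le> (L * (1 / z - z)) * (1 - (real (card S) - 1) * \<epsilon>)"
      using L gap by (intro mult_left_mono[OF down]) simp
    then show "L * z + L * (1 / z - z) * pmf p (t \<otimes> x) \<le>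
        (z + (1 - (real (card S) - 1) * \<epsilon>) * (1 / z - z)) * L"
      by (simp add: algebra_simps)
  qed
  finally show ?thesis
    using L by (simp add: L_def ennreal_mult'')
qed

text \<open>With \<open>q < 1 / 2\<close> bounding the probability of the bad step, the factor \<open>\<rho> = z + q * (1 / z - z)\<close>
  of the previous estimate is less than \<open>1\<close> exactly for \<open>z\<close> strictly between \<open>q / (1 - q)\<close>
  and \<open>1\<close>.\<close>

lemma quenched_linear_growth:
  fixes \<omega> :: "'a \<Rightarrow> 'a pmf" and \<epsilon> :: real
  assumes S: "card S \<ge> 2" and \<epsilon>: "\<epsilon> > 1 / (2 * (real (card S) - 1))"
    and supp: "\<And>y. y \<in> carrier G \<Longrightarrow> set_pmf (\<omega> y) \<subseteq> (\<lambda>s. s \<otimes> y) ` S"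
    and elliptic: "\<And>y s. y \<in> carrier G \<Longrightarrow> s \<in> S \<Longrightarrow> \<epsilon> \<le> pmf (\<omega> y) (s \<otimes> y)"
  shows "AE X in quenched_law G \<omega> \<one>. liminf (\<lambda>n. ereal (real (level G S (X n)) / real n)) > 0"
proof -
  \<comment> \<open>The midpoint of \<open>q / (1 - q)\<close> and \<open>1\<close> is \<open>1 / (2 * (1 - q))\<close>. The maximum with \<open>1 / 4\<close> only
    serves to make \<open>q\<close>, and with it \<open>\<rho>\<close>, positive.\<close>
  define q where "q = max (1 / 4) (1 - (real (card S) - 1) * \<epsilon>)"
  define z where "z = 1 / (2 * (1 - q))"
  define \<rho> where "\<rho> = z + q * (1 / z - z)"
  have "1 < 2 * ((real (card S) - 1) * \<epsilon>)"
    using \<epsilon> S by (simp add: field_simps)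
  then have q: "0 < q" "q < 1 / 2" "1 - (real (card S) - 1) * \<epsilon> \<le> q"
    unfolding q_def max_def by (simp_all split: if_splits)
  have z: "0 < z" "z < 1"
    using q by (simp_all add: z_def field_simps)
  have gap: "0 < 1 / z - z"
    using z mult_strict_mono[of z 1 z 1] by (simp add: field_simps)
  have "\<rho> = q * 2 * (1 - q) + 1 / 2"
    using q by (simp add: \<rho>_def z_def field_simps)
  moreover have "0 < (1 - 2 * q)\<^sup>2" using q by simp
  ultimately have \<rho>: "\<rho> < 1"
    by (simp add: power2_eq_square algebra_simps)
  have \<rho>_pos: "0 < \<rho>"
    using z q gap by (simp add: \<rho>_def add_pos_pos)
  have nonempty: "S \<noteq> {}" using S by auto
  have supp': "set_pmf (\<omega> y) \<subseteq> carrier G" if "y \<in> carrier G" for y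
    using supp[OF that] that gens_closed by auto
  have setsQ: "sets (quenched_law G \<omega> \<one>) = sets (traj_space G)"
    by (rule sets_quenched_law[OF supp']) simp_all
  have step: "(\<integral>\<^sup>+u. ennreal (z ^ level G S u) \<partial>measure_pmf (\<omega> y)) \<le>
      ennreal \<rho> * ennreal (z ^ level G S y)" if y: "y \<in> carrier G" for y
  proof -
    have "z + (1 - (real (card S) - 1) * \<epsilon>) * (1 / z - z) \<le> \<rho>"
      unfolding \<rho>_def using q gap by (intro add_left_mono mult_right_mono) simp_all
    then show ?thesis
      using drift_exp_moment[OF y nonempty supp[OF y] elliptic[OF y] z]
      by (meson ennreal_leI mult_right_mono order_trans zero_le)
  qed
  have moment: "(\<integral>\<^sup>+X. ennreal (z ^ level G S (X n)) \<partial>quenched_law G \<omega> \<one>) \<le> ennreal (\<rho> ^ n)" for n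
    using quenched_contraction[OF countable_free_product_Z_Z2[OF free] supp' one_closed step, of n]
      \<rho>_pos by (simp add: level_one ennreal_power)
  have m: "(\<lambda>X. level G S (X n)) \<in> quenched_law G \<omega> \<one> \<rightarrow>\<^sub>M count_space UNIV" for n
    unfolding measurable_cong_sets[OF setsQ refl] traj_space_def
    by (rule measurable_compose[OF measurable_component_singleton]) simp_all
  show ?thesis
    by (rule AE_linear_growth_of_geometric_moments[OF prob_space_quenched_law[OF supp'] m z \<rho>_pos \<rho> moment])
       simp_all
qed

lemma laws_at_set_pmf:
  assumes T: "transition_laws S T" and p: "p \<in> space (laws_at G T x)"
  shows "set_pmf p \<subseteq> (\<lambda>s. s \<otimes> x) ` S"
proof -
  have "space (laws_at G T x) = map_pmf (translation G x) ` topspace T"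
    unfolding laws_at_def by (rule space_measure_of) (auto dest: openin_subset)
  with p obtain q where "q \<in> topspace T" "p = map_pmf (translation G x) q" by auto
  with T show ?thesis
    by (auto simp: transition_laws_def translation_def)
qed

text \<open>The translation by \<open>inv x\<close> moves the law at \<open>x\<close> to the root and preserves \<open>P\<close>, so the
  almost sure bound at the root holds at every single vertex; there are only countably many.\<close>

lemma AE_elliptic_everywhere:
  assumes T: "transition_laws S T" and P: "env_distribution G T P"
    and shift: "\<And>x. x \<in> carrier G \<Longrightarrow> distr P (env_space G T) (env_shift G x) = P"
    and root: "AE \<omega> in P. \<forall>s\<in>S. pmf (\<omega> \<one>) s > \<epsilon>"
  shows "AE \<omega> in P. \<forall>x\<in>carrier G. \<forall>s\<in>S. pmf (\<omega> x) (s \<otimes> x) > \<epsilon>"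
proof -
  have sets: "sets P = sets (env_space G T)"
    using P by (simp add: env_distribution_def)
  have S: "S \<subseteq> carrier G" using gens_closed by blast
  have "AE \<omega> in P. \<forall>s\<in>S. pmf (\<omega> x) (s \<otimes> x) > \<epsilon>" if x: "x \<in> carrier G" for x
  proof -
    have "AE \<omega> in distr P (env_space G T) (env_shift G (inv x)). \<forall>s\<in>S. pmf (\<omega> \<one>) s > \<epsilon>"
      unfolding shift[OF inv_closed[OF x]] by (rule root)
    then have "AE \<omega> in P. \<forall>s\<in>S. pmf (env_shift G (inv x) \<omega> \<one>) s > \<epsilon>"
      using x by (intro AE_distrD[OF measurable_env_shift[OF is_group S T sets]]) simp_all
    then show ?thesis
    proof (rule AE_mp, intro AE_I2 impI ballI)
      fix \<omega> s assume \<omega>: "\<omega> \<in> space P" and *: "\<forall>s\<in>S. pmf (env_shift G (inv x) \<omega> \<one>) s > \<epsilon>"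
        and s: "s \<in> S"
      have "\<omega> x \<in> space (laws_at G T x)"
        using \<omega> sets_eq_imp_space_eq[OF sets] x by (auto simp: env_space_def space_PiM)
      then have supp: "set_pmf (\<omega> x) \<subseteq> carrier G"
        by (rule laws_at_support[OF is_group S T x])
      have "pmf (env_shift G (inv x) \<omega> \<one>) s = measure (measure_pmf (\<omega> x)) (translation G (inv x) -` {s})"
        using x by (simp add: env_shift_def pmf_map)
      also have "\<dots> = measure (measure_pmf (\<omega> x)) {s \<otimes> x}"
        using supp x gens_closed[OF s]
        by (intro measure_pmf.finite_measure_eq_AE)
           (auto simp: AE_measure_pmf_iff translation_def m_assoc subset_eq)
      finally show "pmf (\<omega> x) (s \<otimes> x) > \<epsilon>"
        using bspec[OF * s] by (simp add: measure_pmf_single)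
    qed
  qed
  then show ?thesis
    by (intro AE_ball_countable[THEN iffD2] countable_free_product_Z_Z2[OF free]) blast
qed

end

lemma AE_annealed_lawI:
  assumes G: "group G" and c: "countable (carrier G)" and S: "S \<subseteq> carrier G"
    and T: "transition_laws S T" and P: "env_distribution G T P" and x: "x \<in> carrier G"
    and R: "Measurable.pred (traj_space G) R"
    and quenched: "AE \<omega> in P. AE X in quenched_law G \<omega> x. R X"
  shows "AE (\<omega>, X) in annealed_law G P x. R X"
proof -
  have Ps: "sets P = sets (env_space G T)" using P by (simp add: env_distribution_def)
  have Q: "(\<lambda>\<omega>. quenched_law G \<omega> x) \<in> P \<rightarrow>\<^sub>M prob_algebra (traj_space G)"
    by (rule measurable_quenched_law[OF G c S T Ps x])
  have sQ: "sets (quenched_law G \<omega> x) = sets (traj_space G)" if "\<omega> \<in> space P" for \<omega>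
    using measurable_space[OF Q that] by (simp add: space_prob_algebra)
  have "(\<lambda>\<omega>. distr (quenched_law G \<omega> x) (P \<Otimes>\<^sub>M traj_space G) (\<lambda>X. (\<omega>, X)))
      \<in> P \<rightarrow>\<^sub>M prob_algebra (P \<Otimes>\<^sub>M traj_space G)"
    by (rule measurable_distr_prob_space2[OF Q]) measurable
  note K = measurable_prob_algebraD[OF this]
  have R': "Measurable.pred (P \<Otimes>\<^sub>M traj_space G) (\<lambda>\<omega>X. R (snd \<omega>X))"
    by (rule measurable_compose[OF measurable_snd R])
  have "AE \<omega>X in annealed_law G P x. R (snd \<omega>X)"
    unfolding annealed_law_def AE_bind[OF K R']
  proof (rule AE_mp[OF quenched AE_I2], rule impI)
    fix \<omega> assume \<omega>: "\<omega> \<in> space P" and AE: "AE X in quenched_law G \<omega> x. R X"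
    have "(\<lambda>X. (\<omega>, X)) \<in> quenched_law G \<omega> x \<rightarrow>\<^sub>M P \<Otimes>\<^sub>M traj_space G"
      unfolding measurable_cong_sets[OF sQ[OF \<omega>] refl] using \<omega> by simp
    then show "AE \<omega>X in distr (quenched_law G \<omega> x) (P \<Otimes>\<^sub>M traj_space G) (\<lambda>X. (\<omega>, X)). R (snd \<omega>X)"
      using AE R' by (subst AE_distr_iff) (simp_all add: pred_def)
  qed
  then show ?thesis by (simp add: case_prod_beta)
qed

theorem theorem2:
  fixes G :: "('g, 'm) monoid_scheme"
    and k r d :: nat
    and a b :: "nat \<Rightarrow> 'g"
    and S :: "'g set"
    and T :: "'g pmf topology"
    and P :: "('g \<Rightarrow> 'g pmf) measure"
  assumes "k + r \<ge> 2" and "d = 2 * k + r" and "d \<ge> 3"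
    and "free_product_Z_Z2 G k r a b"
    and "S = gen_set G k r a b"
    and "transition_laws S T"
    and "env_distribution G T P"
    and "iid_environment G T P"
    and "\<exists>\<epsilon>::real. \<epsilon> > 1 / (2 * (real d - 1)) \<and>
           measure P {\<omega> \<in> space P. \<forall>s\<in>S. pmf (\<omega> \<one>\<^bsub>G\<^esub>) s > \<epsilon>} = 1"
  shows "AE (\<omega>, X) in annealed_law G P \<one>\<^bsub>G\<^esub>.
           liminf (\<lambda>n. ereal (real (level G S (X n)) / real n)) > 0"
proof -
  have "group G" using assms(4) by (simp add: free_product_Z_Z2_def is_free_product_def)
  then interpret Z_Z2_free_product G k r a b S
    using assms(4,5) by (intro Z_Z2_free_product.intro Z_Z2_free_product_axioms.intro)
  interpret prob_space P using assms(7) by (simp add: env_distribution_def)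
  have sets: "sets P = sets (env_space G T)"
    using assms(7) by (simp add: env_distribution_def)
  have c: "countable (carrier G)" by (rule countable_free_product_Z_Z2[OF assms(4)])
  have S: "S \<subseteq> carrier G" using gens_closed by blast
  obtain \<epsilon> :: real where \<epsilon>: "\<epsilon> > 1 / (2 * (real (card S) - 1))"
    and "prob {\<omega> \<in> space P. \<forall>s\<in>S. pmf (\<omega> \<one>\<^bsub>G\<^esub>) s > \<epsilon>} = 1"
    using assms(2,9) card_gens by auto
  then have "AE \<omega> in P. \<forall>s\<in>S. pmf (\<omega> \<one>\<^bsub>G\<^esub>) s > \<epsilon>"
    using AE_prob_1 by fastforce
  moreover have "distr P (env_space G T) (env_shift G x) = P" if "x \<in> carrier G" for x
    using assms(8) that by (simp add: iid_environment_def)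
  ultimately have elliptic: "AE \<omega> in P. \<forall>x\<in>carrier G. \<forall>s\<in>S. pmf (\<omega> x) (s \<otimes>\<^bsub>G\<^esub> x) > \<epsilon>"
    by (intro AE_elliptic_everywhere[OF assms(6,7)])
  have "AE \<omega> in P. AE X in quenched_law G \<omega> \<one>\<^bsub>G\<^esub>.
      liminf (\<lambda>n. ereal (real (level G S (X n)) / real n)) > 0"
  proof (rule AE_mp[OF elliptic AE_I2], rule impI)
    fix \<omega> assume \<omega>: "\<omega> \<in> space P"
      and *: "\<forall>x\<in>carrier G. \<forall>s\<in>S. pmf (\<omega> x) (s \<otimes>\<^bsub>G\<^esub> x) > \<epsilon>"
    have "\<omega> y \<in> space (laws_at G T y)" if "y \<in> carrier G" for y
      using \<omega> sets_eq_imp_space_eq[OF sets] that by (auto simp: env_space_def space_PiM)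
    then show "AE X in quenched_law G \<omega> \<one>\<^bsub>G\<^esub>.
        liminf (\<lambda>n. ereal (real (level G S (X n)) / real n)) > 0"
      using * assms(2,3) card_gens
      by (intro quenched_linear_growth[OF _ \<epsilon>] laws_at_set_pmf[OF assms(6)])
         (auto intro: less_imp_le)
  qed
  moreover have "Measurable.pred (traj_space G)
      (\<lambda>X. liminf (\<lambda>n. ereal (real (level G S (X n)) / real n)) > 0)"
  proof -
    have "(\<lambda>X. ereal (real (level G S (X n)) / real n)) \<in> borel_measurable (traj_space G)" for n
      unfolding traj_space_def
      by (rule measurable_compose[OF measurable_component_singleton]) simp_all
    then have [measurable]: "(\<lambda>X. liminf (\<lambda>n. ereal (real (level G S (X n)) / real n)))
        \<in> borel_measurable (traj_space G)"
      by (rule borel_measurable_liminf)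
    show ?thesis by measurable
  qed
  ultimately show ?thesis
    by (intro AE_annealed_lawI[OF \<open>group G\<close> c S assms(6,7)]) simp_all
qed

end
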